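(* Let $R$ be a semiprime ring. Then: 1. The ring $Q_l(R)$ is a semiprime ring. 2. If, in addition, $|\min(R)|<\infty$, then: (a) $\min(Q_l(R))=\{S_l(R)^{-1}\mathfrak{p}\mid\mathfrak{p}\in\min(R)\}$. (b) For all $\mathfrak{p}\in\min(R)$, $\pi_{\mathfrak{p}}(S_l(R))\in\mathrm{Den}_l(R/\mathfrak{p},0)$ and $$\pi_{\mathfrak{p}}(S_l(R))^{-1}(R/\mathfrak{p})\simeq S_l(R)^{-1}R/S_l(R)^{-1}\mathfrak{p}\simeq Q_l(R)/S_l(R)^{-1}\mathfrak{p}\simeq S_l(R)^{-1}(R/\mathfrak{p}),$$ where $\pi_{\mathfrak{p}}:R\to R/\mathfrak{p}$, $r\mapsto r+\mathfrak{p}$. (c) For all $\mathfrak{p}\in\min(R)$, $\pi_{\mathfrak{p}}(S_l(R))\subseteq S_l(R/\mathfrak{p})$ and $Q_l(R)/S_l(R)^{-1}\mathfrak{p}\subseteq Q_l(R/\mathfrak{p})$.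
   Context: Rings are associative with $1$. A multiplicative subset $S$ of $R$ is a multiplicative subsemigroup with $1\in S$, $0\notin S$. It is a left Ore set if $Sr\cap Rs\neq\emptyset$ for all $r\in R$, $s\in S$. A left Ore set $S$ is a left denominator set if $rs=0$ with $r\in R$, $s\in S$ implies $tr=0$ for some $t\in S$. $\mathrm{Den}_l(R,0)$ is the set of left denominator sets $S$ of $R$ with $\{r\in R\mid sr=0\text{ for some }s\in S\}=0$ (equivalently, left Ore sets consisting of regular elements, i.e. non-zero-divisors). $S^{-1}R=\{s^{-1}r\mid s\in S,r\in R\}$ is the left localization, $S^{-1}\mathfrak{p}=\{s^{-1}p\mid s\in S,p\in\mathfrak{p}\}$, and $S^{-1}(R/\mathfrak{p})$ is the localization of the left module $R/\mathfrak{p}$. For every ring $R$ there exists a largest (with respect to inclusion) left Ore set $S_l(R)$ consisting of regular elements of $R$; $Q_l(R):=S_l(R)^{-1}R$ is called the largest left quotient ring of $R$. The inclusion in (c) is via the natural map $s^{-1}r+S_l(R)^{-1}\mathfrak{p}\mapsto\pi_{\mathfrak{p}}(s)^{-1}\pi_{\mathfrak{p}}(r)$. A ring is semiprime if the intersection of its prime ideals is zero; $\min(R)$ is the set of minimal primes of $R$. *)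

theory Defs
  imports "HOL-Algebra.Ideal_Product" "HOL-Algebra.QuotRing" "HOL-Algebra.Module"
begin

section \<open>Prime ideals in noncommutative rings\<close>

text \<open>The library's \<^locale>\<open>primeideal\<close> lives in commutative rings and is an elementwise
  condition; over a general ring primeness is a condition on products of two-sided ideals.\<close>

definition nc_prime_ideal :: "('a, 'b) ring_scheme \<Rightarrow> 'a set \<Rightarrow> bool"
  where "nc_prime_ideal R P \<longleftrightarrow> ideal P R \<and> P \<noteq> carrier R \<and>
    (\<forall>I J. ideal I R \<longrightarrow> ideal J R \<longrightarrow> I \<cdot>\<^bsub>R\<^esub> J \<subseteq> P \<longrightarrow> I \<subseteq> P \<or> J \<subseteq> P)"

definition min_primes :: "('a, 'b) ring_scheme \<Rightarrow> 'a set set"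
  where "min_primes R =
    {P. nc_prime_ideal R P \<and> (\<forall>P'. nc_prime_ideal R P' \<longrightarrow> P' \<subseteq> P \<longrightarrow> P' = P)}"

text \<open>The zero ring is excluded: it has no prime ideals and, since multiplicative subsets
  contain \<open>1\<close> but not \<open>0\<close>, no multiplicative subsets either.\<close>

locale semiprime_ring = ring R for R (structure) +
  assumes one_neq_zero: "\<one> \<noteq> \<zero>"
    and Inter_primes: "{r \<in> carrier R. \<forall>P. nc_prime_ideal R P \<longrightarrow> r \<in> P} = {\<zero>}"


section \<open>Left Ore sets and left denominator sets\<close>

definition multiplicative_subset :: "('a, 'b) ring_scheme \<Rightarrow> 'a set \<Rightarrow> bool"
  where "multiplicative_subset R S \<longleftrightarrow> S \<subseteq> carrier R \<and> \<one>\<^bsub>R\<^esub> \<in> S \<and> \<zero>\<^bsub>R\<^esub> \<notin> S \<and>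
    (\<forall>s\<in>S. \<forall>t\<in>S. s \<otimes>\<^bsub>R\<^esub> t \<in> S)"

definition left_Ore_set :: "('a, 'b) ring_scheme \<Rightarrow> 'a set \<Rightarrow> bool"
  where "left_Ore_set R S \<longleftrightarrow> multiplicative_subset R S \<and>
    (\<forall>r\<in>carrier R. \<forall>s\<in>S. {t \<otimes>\<^bsub>R\<^esub> r |t. t \<in> S} \<inter> {a \<otimes>\<^bsub>R\<^esub> s |a. a \<in> carrier R} \<noteq> {})"

definition left_denominator_set :: "('a, 'b) ring_scheme \<Rightarrow> 'a set \<Rightarrow> bool"
  where "left_denominator_set R S \<longleftrightarrow> left_Ore_set R S \<and>
    (\<forall>r\<in>carrier R. \<forall>s\<in>S. r \<otimes>\<^bsub>R\<^esub> s = \<zero>\<^bsub>R\<^esub> \<longrightarrow> (\<exists>t\<in>S. t \<otimes>\<^bsub>R\<^esub> r = \<zero>\<^bsub>R\<^esub>))"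

definition Den_l :: "('a, 'b) ring_scheme \<Rightarrow> 'a set \<Rightarrow> 'a set set"
  where "Den_l R I = {S. left_denominator_set R S \<and>
    {r \<in> carrier R. \<exists>s\<in>S. s \<otimes>\<^bsub>R\<^esub> r = \<zero>\<^bsub>R\<^esub>} = I}"

definition regular_elements :: "('a, 'b) ring_scheme \<Rightarrow> 'a set"
  where "regular_elements R = {a \<in> carrier R. \<forall>x\<in>carrier R.
    (a \<otimes>\<^bsub>R\<^esub> x = \<zero>\<^bsub>R\<^esub> \<longrightarrow> x = \<zero>\<^bsub>R\<^esub>) \<and> (x \<otimes>\<^bsub>R\<^esub> a = \<zero>\<^bsub>R\<^esub> \<longrightarrow> x = \<zero>\<^bsub>R\<^esub>)}"

definition is_largest_regular_left_Ore_set :: "('a, 'b) ring_scheme \<Rightarrow> 'a set \<Rightarrow> bool"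
  where "is_largest_regular_left_Ore_set R S \<longleftrightarrow>
    left_Ore_set R S \<and> S \<subseteq> regular_elements R \<and>
    (\<forall>T. left_Ore_set R T \<longrightarrow> T \<subseteq> regular_elements R \<longrightarrow> T \<subseteq> S)"

definition S_l :: "('a, 'b) ring_scheme \<Rightarrow> 'a set"
  where "S_l R = (THE S. is_largest_regular_left_Ore_set R S)"

text \<open>The description in \<^const>\<open>S_l\<close> is proper: the submonoid generated by all left Ore sets of
  regular elements is the largest one.\<close>

inductive_set Ore_generated :: "('a, 'b) ring_scheme \<Rightarrow> 'a set" for R
  where
    one: "\<one>\<^bsub>R\<^esub> \<in> Ore_generated R"
  | step: "\<lbrakk> left_Ore_set R T; T \<subseteq> regular_elements R; t \<in> T; s \<in> Ore_generated R \<rbrakk>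
      \<Longrightarrow> t \<otimes>\<^bsub>R\<^esub> s \<in> Ore_generated R"

lemma S_l_largest:
  assumes "ring R" and nz: "\<one>\<^bsub>R\<^esub> \<noteq> \<zero>\<^bsub>R\<^esub>"
  shows "is_largest_regular_left_Ore_set R (S_l R)"
proof -
  interpret ring R by fact
  let ?G = "Ore_generated R"
  have reg_carr: "a \<in> carrier R" if "a \<in> regular_elements R" for a
    using that unfolding regular_elements_def by blast
  have reg_l: "x = \<zero>\<^bsub>R\<^esub>"
    if "a \<in> regular_elements R" "x \<in> carrier R" "a \<otimes>\<^bsub>R\<^esub> x = \<zero>\<^bsub>R\<^esub>" for a x
    using that unfolding regular_elements_def by blast
  have reg_r: "x = \<zero>\<^bsub>R\<^esub>"
    if "a \<in> regular_elements R" "x \<in> carrier R" "x \<otimes>\<^bsub>R\<^esub> a = \<zero>\<^bsub>R\<^esub>" for a x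
    using that unfolding regular_elements_def by blast
  have reg: "s \<in> regular_elements R" if "s \<in> ?G" for s
    using that
  proof (induction rule: Ore_generated.induct)
    case one
    then show ?case by (simp add: regular_elements_def)
  next
    case (step T t s)
    then have t: "t \<in> regular_elements R" by auto
    with step.IH have c: "t \<in> carrier R" "s \<in> carrier R" by (simp_all add: reg_carr)
    show ?case
      unfolding regular_elements_def
    proof (intro CollectI conjI ballI impI)
      show "t \<otimes>\<^bsub>R\<^esub> s \<in> carrier R" using c by simp
      fix x assume x: "x \<in> carrier R"
      show "x = \<zero>\<^bsub>R\<^esub>" if "t \<otimes>\<^bsub>R\<^esub> s \<otimes>\<^bsub>R\<^esub> x = \<zero>\<^bsub>R\<^esub>"
      proof -
        have "t \<otimes>\<^bsub>R\<^esub> (s \<otimes>\<^bsub>R\<^esub> x) = \<zero>\<^bsub>R\<^esub>" using that c x by (simp add: m_assoc)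
        then have "s \<otimes>\<^bsub>R\<^esub> x = \<zero>\<^bsub>R\<^esub>" using reg_l[OF t] c x by simp
        then show ?thesis using reg_l[OF step.IH x] by simp
      qed
      show "x = \<zero>\<^bsub>R\<^esub>" if "x \<otimes>\<^bsub>R\<^esub> (t \<otimes>\<^bsub>R\<^esub> s) = \<zero>\<^bsub>R\<^esub>"
      proof -
        have "(x \<otimes>\<^bsub>R\<^esub> t) \<otimes>\<^bsub>R\<^esub> s = \<zero>\<^bsub>R\<^esub>" using that c x by (simp add: m_assoc)
        then have "x \<otimes>\<^bsub>R\<^esub> t = \<zero>\<^bsub>R\<^esub>" using reg_r[OF step.IH] c x by simp
        then show ?thesis using reg_r[OF t x] by simp
      qed
    qed
  qed
  then have carr: "?G \<subseteq> carrier R" by (blast intro: reg_carr)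
  have sub: "T \<subseteq> ?G" if "left_Ore_set R T" "T \<subseteq> regular_elements R" for T
  proof
    fix t assume "t \<in> T"
    then have "t \<otimes>\<^bsub>R\<^esub> \<one>\<^bsub>R\<^esub> \<in> ?G"
      by (rule Ore_generated.step[OF that _ Ore_generated.one])
    moreover have "t \<in> carrier R"
      using that(2) \<open>t \<in> T\<close> by (blast intro: reg_carr)
    ultimately show "t \<in> ?G" by simp
  qed
  have mult: "s \<otimes>\<^bsub>R\<^esub> t \<in> ?G" if "s \<in> ?G" "t \<in> ?G" for s t
    using that(1)
  proof (induction rule: Ore_generated.induct)
    case one
    then show ?case using carr that by auto
  next
    case (step T u s)
    have "u \<in> carrier R" "s \<in> carrier R" "t \<in> carrier R"
      using step(2-4) carr that(2) by (blast intro: reg_carr)+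
    then show ?case using Ore_generated.step[OF step(1-3) step.IH] by (simp add: m_assoc)
  qed
  have ore: "\<forall>r\<in>carrier R. \<exists>t\<in>?G. \<exists>a\<in>carrier R. t \<otimes>\<^bsub>R\<^esub> r = a \<otimes>\<^bsub>R\<^esub> s" if "s \<in> ?G" for s
    using that
  proof (induction rule: Ore_generated.induct)
    case one
    then show ?case using Ore_generated.one[of R] by auto
  next
    case (step T u s)
    have c: "u \<in> carrier R" "s \<in> carrier R"
      using step(2-4) carr by (blast intro: reg_carr)+
    show ?case
    proof
      fix r assume r: "r \<in> carrier R"
      obtain t a where t: "t \<in> ?G" "a \<in> carrier R" "t \<otimes>\<^bsub>R\<^esub> r = a \<otimes>\<^bsub>R\<^esub> s"
        using step.IH r by blast
      obtain v b where v: "v \<in> T" "b \<in> carrier R" "v \<otimes>\<^bsub>R\<^esub> a = b \<otimes>\<^bsub>R\<^esub> u"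
        using step(1,3) t(2) unfolding left_Ore_set_def by blast
      have vG: "v \<in> ?G" using sub[OF step(1,2)] v by auto
      have "(v \<otimes>\<^bsub>R\<^esub> t) \<otimes>\<^bsub>R\<^esub> r = b \<otimes>\<^bsub>R\<^esub> (u \<otimes>\<^bsub>R\<^esub> s)"
      proof -
        have tc: "t \<in> carrier R" "v \<in> carrier R" using t(1) vG carr by auto
        have "(v \<otimes>\<^bsub>R\<^esub> t) \<otimes>\<^bsub>R\<^esub> r = v \<otimes>\<^bsub>R\<^esub> (a \<otimes>\<^bsub>R\<^esub> s)"
          using t(3) tc r by (simp add: m_assoc)
        also have "\<dots> = (v \<otimes>\<^bsub>R\<^esub> a) \<otimes>\<^bsub>R\<^esub> s"
          using tc t(2) c by (simp add: m_assoc)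
        also have "\<dots> = (b \<otimes>\<^bsub>R\<^esub> u) \<otimes>\<^bsub>R\<^esub> s" by (simp only: v(3))
        also have "\<dots> = b \<otimes>\<^bsub>R\<^esub> (u \<otimes>\<^bsub>R\<^esub> s)" using v(2) c by (simp add: m_assoc)
        finally show ?thesis .
      qed
      then show "\<exists>t\<in>?G. \<exists>a\<in>carrier R. t \<otimes>\<^bsub>R\<^esub> r = a \<otimes>\<^bsub>R\<^esub> (u \<otimes>\<^bsub>R\<^esub> s)"
        using mult[OF vG t(1)] v(2) by blast
    qed
  qed
  have "\<zero>\<^bsub>R\<^esub> \<notin> ?G"
  proof
    assume "\<zero>\<^bsub>R\<^esub> \<in> ?G"
    then have "\<one>\<^bsub>R\<^esub> = \<zero>\<^bsub>R\<^esub>" using reg_l[OF reg] by simp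
    with nz show False ..
  qed
  then have "multiplicative_subset R ?G"
    unfolding multiplicative_subset_def using carr mult by (simp add: Ore_generated.one)
  moreover have "{t \<otimes>\<^bsub>R\<^esub> r |t. t \<in> ?G} \<inter> {a \<otimes>\<^bsub>R\<^esub> s |a. a \<in> carrier R} \<noteq> {}"
    if "r \<in> carrier R" "s \<in> ?G" for r s
    using ore[OF that(2)] that(1) by blast
  ultimately have "left_Ore_set R ?G" by (simp add: left_Ore_set_def)
  then have G: "is_largest_regular_left_Ore_set R ?G"
    unfolding is_largest_regular_left_Ore_set_def using reg sub by (simp add: subsetI)
  show ?thesis
    unfolding S_l_def
  proof (rule theI, rule G)
    fix S assume "is_largest_regular_left_Ore_set R S"
    with G show "S = ?G"
      unfolding is_largest_regular_left_Ore_set_def by (intro equalityI) simp_all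
  qed
qed


section \<open>Left localization\<close>

text \<open>The library's \<^locale>\<open>module\<close> requires a commutative ring of scalars; only its record type
  is used here, for left modules. \<open>restrict_scalars f B\<close> is the ring \<open>B\<close> regarded as a left
  module along a ring homomorphism \<open>f\<close> into \<open>B\<close>.\<close>

definition restrict_scalars :: "('a \<Rightarrow> 'b) \<Rightarrow> ('b, 'c) ring_scheme \<Rightarrow> ('a, 'b) module"
  where "restrict_scalars f B =
    \<lparr>carrier = carrier B, monoid.mult = monoid.mult B, one = \<one>\<^bsub>B\<^esub>, ring.zero = \<zero>\<^bsub>B\<^esub>, add = add B,
     smult = (\<lambda>a b. f a \<otimes>\<^bsub>B\<^esub> b)\<rparr>"

abbreviation regular_module :: "('a, 'b) ring_scheme \<Rightarrow> ('a, 'a) module"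
  where "regular_module R \<equiv> restrict_scalars (\<lambda>r. r) R"

text \<open>\<open>left_frac R S M s m\<close> is the fraction \<open>s\<^sup>-\<^sup>1m\<close>, as a class of pairs: \<open>s\<^sup>-\<^sup>1m = t\<^sup>-\<^sup>1n\<close> iff
  the two fractions can be expanded to one with the same denominator in \<open>S\<close> and the same
  numerator.\<close>

definition frac_rel ::
  "('a, 'c) ring_scheme \<Rightarrow> 'a set \<Rightarrow> ('a, 'b, 'd) module_scheme \<Rightarrow> (('a \<times> 'b) \<times> ('a \<times> 'b)) set"
  where "frac_rel R S M = {((s, m), (t, n)).
    s \<in> S \<and> m \<in> carrier M \<and> t \<in> S \<and> n \<in> carrier M \<and>
    (\<exists>a\<in>carrier R. \<exists>b\<in>carrier R.
      a \<otimes>\<^bsub>R\<^esub> s \<in> S \<and> a \<otimes>\<^bsub>R\<^esub> s = b \<otimes>\<^bsub>R\<^esub> t \<and> a \<odot>\<^bsub>M\<^esub> m = b \<odot>\<^bsub>M\<^esub> n)}"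

definition left_frac ::
  "('a, 'c) ring_scheme \<Rightarrow> 'a set \<Rightarrow> ('a, 'b, 'd) module_scheme \<Rightarrow> 'a \<Rightarrow> 'b \<Rightarrow> ('a \<times> 'b) set"
  where "left_frac R S M s m = frac_rel R S M `` {(s, m)}"

text \<open>\<open>s\<^sup>-\<^sup>1m + t\<^sup>-\<^sup>1n = (cs)\<^sup>-\<^sup>1(cm + dn)\<close> whenever \<open>cs = dt \<in> S\<close>. As with
  \<^const>\<open>rcoset_mult\<close>, the union runs over all representatives and choices, which give the same
  class when \<open>S\<close> is a left denominator set.\<close>

definition frac_add ::
  "('a, 'c) ring_scheme \<Rightarrow> 'a set \<Rightarrow> ('a, 'b, 'd) module_scheme \<Rightarrow>
    ('a \<times> 'b) set \<Rightarrow> ('a \<times> 'b) set \<Rightarrow> ('a \<times> 'b) set"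
  where "frac_add R S M X Y =
    \<Union>{left_frac R S M (c \<otimes>\<^bsub>R\<^esub> s) (c \<odot>\<^bsub>M\<^esub> m \<oplus>\<^bsub>M\<^esub> d \<odot>\<^bsub>M\<^esub> n) |s m t n c d.
      (s, m) \<in> X \<and> (t, n) \<in> Y \<and> c \<in> carrier R \<and> d \<in> carrier R \<and>
      c \<otimes>\<^bsub>R\<^esub> s \<in> S \<and> c \<otimes>\<^bsub>R\<^esub> s = d \<otimes>\<^bsub>R\<^esub> t}"

text \<open>\<open>s\<^sup>-\<^sup>1r \<cdot> t\<^sup>-\<^sup>1m = (cs)\<^sup>-\<^sup>1(am)\<close> whenever \<open>cr = at\<close> with \<open>c \<in> S\<close>. For the regular module
  this is the multiplication of the localized ring.\<close>

definition frac_smult ::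
  "('a, 'c) ring_scheme \<Rightarrow> 'a set \<Rightarrow> ('a, 'b, 'd) module_scheme \<Rightarrow>
    ('a \<times> 'a) set \<Rightarrow> ('a \<times> 'b) set \<Rightarrow> ('a \<times> 'b) set"
  where "frac_smult R S M X Y =
    \<Union>{left_frac R S M (c \<otimes>\<^bsub>R\<^esub> s) (a \<odot>\<^bsub>M\<^esub> m) |s r t m c a.
      (s, r) \<in> X \<and> (t, m) \<in> Y \<and> c \<in> S \<and> a \<in> carrier R \<and> c \<otimes>\<^bsub>R\<^esub> r = a \<otimes>\<^bsub>R\<^esub> t}"

abbreviation ring_frac :: "('a, 'b) ring_scheme \<Rightarrow> 'a set \<Rightarrow> 'a \<Rightarrow> 'a \<Rightarrow> ('a \<times> 'a) set"
  where "ring_frac R S s r \<equiv> left_frac R S (regular_module R) s r"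

definition left_loc :: "('a, 'b) ring_scheme \<Rightarrow> 'a set \<Rightarrow> ('a \<times> 'a) set ring"
  where "left_loc R S =
    \<lparr>carrier = {ring_frac R S s r |s r. s \<in> S \<and> r \<in> carrier R},
     monoid.mult = frac_smult R S (regular_module R),
     one = ring_frac R S \<one>\<^bsub>R\<^esub> \<one>\<^bsub>R\<^esub>,
     ring.zero = ring_frac R S \<one>\<^bsub>R\<^esub> \<zero>\<^bsub>R\<^esub>,
     add = frac_add R S (regular_module R)\<rparr>"

text \<open>The ring fields \<^const>\<open>mult\<close> and \<^const>\<open>one\<close> of a module record play no role.\<close>

definition left_loc_module ::
  "('a, 'c) ring_scheme \<Rightarrow> 'a set \<Rightarrow> ('a, 'b, 'd) module_scheme \<Rightarrow>
    (('a \<times> 'a) set, ('a \<times> 'b) set) module"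
  where "left_loc_module R S M =
    \<lparr>carrier = {left_frac R S M s m |s m. s \<in> S \<and> m \<in> carrier M},
     monoid.mult = undefined,
     one = undefined,
     ring.zero = left_frac R S M \<one>\<^bsub>R\<^esub> \<zero>\<^bsub>M\<^esub>,
     add = frac_add R S M,
     smult = frac_smult R S M\<rparr>"

definition loc_ideal :: "('a, 'b) ring_scheme \<Rightarrow> 'a set \<Rightarrow> 'a set \<Rightarrow> ('a \<times> 'a) set set"
  where "loc_ideal R S P = {ring_frac R S s p |s p. s \<in> S \<and> p \<in> P}"

definition Q_l :: "('a, 'b) ring_scheme \<Rightarrow> ('a \<times> 'a) set ring"
  where "Q_l R = left_loc R (S_l R)"


section \<open>Quotients and isomorphisms of left modules\<close>

abbreviation quot_map :: "('a, 'b) ring_scheme \<Rightarrow> 'a set \<Rightarrow> 'a \<Rightarrow> 'a set"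
  where "quot_map R I \<equiv> (\<lambda>r. I +>\<^bsub>R\<^esub> r)"

abbreviation quot_module :: "('a, 'b) ring_scheme \<Rightarrow> 'a set \<Rightarrow> ('a, 'a set) module"
  where "quot_module R I \<equiv> restrict_scalars (quot_map R I) (R Quot I)"

definition left_module_iso ::
  "('a, 'e) ring_scheme \<Rightarrow> ('a, 'b, 'c) module_scheme \<Rightarrow> ('a, 'b2, 'd) module_scheme \<Rightarrow>
    ('b \<Rightarrow> 'b2) set"
  where "left_module_iso R M N = {h. bij_betw h (carrier M) (carrier N) \<and>
    (\<forall>x\<in>carrier M. \<forall>y\<in>carrier M. h (x \<oplus>\<^bsub>M\<^esub> y) = h x \<oplus>\<^bsub>N\<^esub> h y) \<and>
    (\<forall>a\<in>carrier R. \<forall>x\<in>carrier M. h (a \<odot>\<^bsub>M\<^esub> x) = a \<odot>\<^bsub>N\<^esub> h x)}"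

end

theory Submission
  imports Defs "HOL-Algebra.Ring_Divisibility"
begin

text \<open>Let \<open>S\<close> be the largest left Ore set of regular elements of \<open>R\<close> and \<open>Q\<close> the ring of fractions.
  Semiprimeness of a ring \<open>A\<close> means that \<open>a A a = 0\<close> forces \<open>a = 0\<close>. If \<open>x = s\<^sup>-\<^sup>1a\<close> and \<open>x Q x = 0\<close>,
  then \<open>s\<^sup>-\<^sup>1(a r a) = x (r s) x = 0\<close> for every \<open>r\<close> in \<open>R\<close>, hence \<open>a = 0\<close>.
  When there are finitely many minimal primes, some \<open>e\<close> outside the minimal prime \<open>\<pp>\<close> lies in all others,
  and \<open>\<pp>\<close> is both \<open>{x. x R e = 0}\<close> and \<open>{x. e R x = 0}\<close>. Therefore \<open>s r \<in> \<pp>\<close> or \<open>r s \<in> \<pp>\<close> with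
  \<open>s\<close> regular implies \<open>r \<in> \<pp>\<close>, so \<open>S\<close> maps to a left Ore set of regular elements of \<open>R/\<pp>\<close> and
  \<open>S\<^sup>-\<^sup>1\<pp>\<close> is the kernel of \<open>Q \<rightarrow> \<pi>(S)\<^sup>-\<^sup>1(R/\<pp>)\<close>; in particular it is a two-sided ideal, and it is
  prime. The \<open>S\<^sup>-\<^sup>1\<pp>\<close> are finitely many incomparable primes with zero intersection, so they are the
  minimal primes of \<open>Q\<close>.\<close>

section \<open>Fractions with regular denominators\<close>

text \<open>Intended for \<open>frac_add\<close> and \<open>frac_smult\<close>, which are unions
  over all representatives: once every choice is shown to give the same class, the union collapses
  to it.\<close>

lemma Union_eq_memberI: "\<lbrakk> \<And>Y. Y \<in> \<A> \<Longrightarrow> Y = X; X \<in> \<A> \<rbrakk> \<Longrightarrow> \<Union>\<A> = X"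
  by blast

lemma restrict_scalars_simps [simp]:
  "carrier (restrict_scalars f B) = carrier B"
  "x \<oplus>\<^bsub>restrict_scalars f B\<^esub> y = x \<oplus>\<^bsub>B\<^esub> y"
  "a \<odot>\<^bsub>restrict_scalars f B\<^esub> x = f a \<otimes>\<^bsub>B\<^esub> x"
  "\<zero>\<^bsub>restrict_scalars f B\<^esub> = \<zero>\<^bsub>B\<^esub>"
  by (simp_all add: restrict_scalars_def)

lemma abelian_group_restrict_scalars:
  assumes "abelian_group B"
  shows "abelian_group (restrict_scalars f B)"
proof -
  interpret B: abelian_group B by fact
  show ?thesis
    by (rule abelian_groupI) (auto simp: B.a_ac intro: B.l_neg B.a_inv_closed)
qed

lemma (in abelian_group) eq_if_minus_eq_zero:
  assumes "x \<in> carrier G" "y \<in> carrier G" "x \<ominus> y = \<zero>"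
  shows "x = y"
  using assms by (metis a_minus_def a_inv_closed local.minus_minus minus_equality)

text \<open>Keeping \<open>S\<close> general allows one theory to serve \<open>S_l R\<close> in
  \<open>R\<close> as well as the image of \<open>S_l R\<close> and the set
  \<open>S_l (R Quot I)\<close> in a quotient ring.\<close>

locale regular_left_Ore = ring R for R (structure) +
  fixes S
  assumes Ore: "left_Ore_set R S" and reg: "S \<subseteq> regular_elements R"
begin

lemma S_closed [simp, intro]: "s \<in> S \<Longrightarrow> s \<in> carrier R"
  using reg unfolding regular_elements_def by blast

lemma S_one [simp, intro]: "\<one> \<in> S"
  and S_mult [intro]: "s \<in> S \<Longrightarrow> t \<in> S \<Longrightarrow> s \<otimes> t \<in> S"
  and S_zero: "\<zero> \<notin> S"
  using Ore unfolding left_Ore_set_def multiplicative_subset_def by auto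

lemma one_not_zero: "\<one> \<noteq> \<zero>"
  using S_one S_zero by metis

lemma S_left_regular:
  assumes "s \<in> S" "x \<in> carrier R" "s \<otimes> x = \<zero>"
  shows "x = \<zero>"
  using reg assms unfolding regular_elements_def by blast

lemma S_right_regular:
  assumes "s \<in> S" "x \<in> carrier R" "x \<otimes> s = \<zero>"
  shows "x = \<zero>"
  using reg assms unfolding regular_elements_def by blast

lemma S_right_cancel:
  assumes "s \<in> S" "x \<in> carrier R" "y \<in> carrier R" "x \<otimes> s = y \<otimes> s"
  shows "x = y"
proof -
  have "(x \<ominus> y) \<otimes> s = \<zero>"
    using assms by (simp add: l_distr l_minus a_minus_def r_neg)
  then have "x \<ominus> y = \<zero>"
    using S_right_regular[OF assms(1)] assms by simp
  then show ?thesis using eq_if_minus_eq_zero assms by blast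
qed

lemma Ore_obtain:
  assumes "r \<in> carrier R" "s \<in> S"
  obtains c a where "c \<in> S" "a \<in> carrier R" "c \<otimes> r = a \<otimes> s"
  using Ore assms unfolding left_Ore_set_def by blast

end

text \<open>Left modules on which every element of \<open>S\<close> acts injectively. Fractions with
  numerators in \<open>R\<close> and fractions with numerators in \<open>R Quot I\<close> are both
  covered, so their arithmetic is developed only once.\<close>

locale torsionfree_module = regular_left_Ore +
  fixes M :: "('a, 'c, 'd) module_scheme"
  assumes M_group: "abelian_group M"
    and smult_closed [simp, intro]: "\<lbrakk> a \<in> carrier R; x \<in> carrier M \<rbrakk> \<Longrightarrow> a \<odot>\<^bsub>M\<^esub> x \<in> carrier M"
    and smult_r_distr: "\<lbrakk> a \<in> carrier R; x \<in> carrier M; y \<in> carrier M \<rbrakk>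
      \<Longrightarrow> a \<odot>\<^bsub>M\<^esub> (x \<oplus>\<^bsub>M\<^esub> y) = a \<odot>\<^bsub>M\<^esub> x \<oplus>\<^bsub>M\<^esub> a \<odot>\<^bsub>M\<^esub> y"
    and smult_l_distr: "\<lbrakk> a \<in> carrier R; b \<in> carrier R; x \<in> carrier M \<rbrakk>
      \<Longrightarrow> (a \<oplus> b) \<odot>\<^bsub>M\<^esub> x = a \<odot>\<^bsub>M\<^esub> x \<oplus>\<^bsub>M\<^esub> b \<odot>\<^bsub>M\<^esub> x"
    and smult_assoc: "\<lbrakk> a \<in> carrier R; b \<in> carrier R; x \<in> carrier M \<rbrakk>
      \<Longrightarrow> (a \<otimes> b) \<odot>\<^bsub>M\<^esub> x = a \<odot>\<^bsub>M\<^esub> (b \<odot>\<^bsub>M\<^esub> x)"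
    and smult_one [simp]: "x \<in> carrier M \<Longrightarrow> \<one> \<odot>\<^bsub>M\<^esub> x = x"
    and torsionfree: "\<lbrakk> s \<in> S; x \<in> carrier M; y \<in> carrier M; s \<odot>\<^bsub>M\<^esub> x = s \<odot>\<^bsub>M\<^esub> y \<rbrakk> \<Longrightarrow> x = y"

text \<open>The module axioms are inherited from \<open>B\<close> through \<open>f\<close>, and
  since the action is additive, injectivity of each \<open>s\<close> reduces to a trivial kernel.
  The instances are the identity of \<open>R\<close> and the projection onto
  \<open>R Quot I\<close>.\<close>

lemma (in regular_left_Ore) torsionfree_restrict_scalars:
  assumes "ring B" and f: "f \<in> ring_hom R B"
    and tf: "\<And>s x. \<lbrakk> s \<in> S; x \<in> carrier B; f s \<otimes>\<^bsub>B\<^esub> x = \<zero>\<^bsub>B\<^esub> \<rbrakk> \<Longrightarrow> x = \<zero>\<^bsub>B\<^esub>"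
  shows "torsionfree_module R S (restrict_scalars f B)"
proof -
  interpret B: ring B by fact
  have fc: "f a \<in> carrier B" if "a \<in> carrier R" for a
    using f that by (rule ring_hom_closed)
  show ?thesis
  proof (intro torsionfree_module.intro torsionfree_module_axioms.intro regular_left_Ore_axioms)
    show "abelian_group (restrict_scalars f B)"
      by (intro abelian_group_restrict_scalars B.abelian_group_axioms)
    fix s x y
    assume "s \<in> S" "x \<in> carrier (restrict_scalars f B)" "y \<in> carrier (restrict_scalars f B)"
      and eq: "s \<odot>\<^bsub>restrict_scalars f B\<^esub> x = s \<odot>\<^bsub>restrict_scalars f B\<^esub> y"
    then have c: "s \<in> S" "x \<in> carrier B" "y \<in> carrier B" "f s \<in> carrier B"
      by (simp_all add: fc)
    have "f s \<otimes>\<^bsub>B\<^esub> (x \<ominus>\<^bsub>B\<^esub> y) = \<zero>\<^bsub>B\<^esub>"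
      using eq c by (simp add: B.r_distr B.r_minus a_minus_def B.r_neg)
    then have "x \<ominus>\<^bsub>B\<^esub> y = \<zero>\<^bsub>B\<^esub>" using tf c by simp
    then show "x = y" using B.eq_if_minus_eq_zero c by blast
  qed (use f fc in \<open>simp_all add: B.r_distr B.l_distr B.m_assoc
      ring_hom_add[OF f] ring_hom_mult[OF f] ring_hom_one[OF f]\<close>)
qed

lemma (in regular_left_Ore) torsionfree_regular_module:
  "torsionfree_module R S (regular_module R)"
  by (rule torsionfree_restrict_scalars) (auto intro: S_left_regular ring_axioms simp: ring_hom_def)

section \<open>Arithmetic of fractions with numerators in a module\<close>

context torsionfree_module
begin

abbreviation frac :: "'a \<Rightarrow> 'c \<Rightarrow> ('a \<times> 'c) set"
  where "frac \<equiv> left_frac R S M"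

text \<open>Torsion-freeness lets every pair of expansions be tested instead of finding one, which makes
  independence of representatives a direct computation.\<close>

lemma frac_rel_iff:
  "((s, m), (t, n)) \<in> frac_rel R S M \<longleftrightarrow> s \<in> S \<and> m \<in> carrier M \<and> t \<in> S \<and> n \<in> carrier M \<and>
    (\<forall>u\<in>carrier R. \<forall>v\<in>carrier R. u \<otimes> s = v \<otimes> t \<longrightarrow> u \<odot>\<^bsub>M\<^esub> m = v \<odot>\<^bsub>M\<^esub> n)"
  (is "?L \<longleftrightarrow> ?R")
proof
  assume ?L
  then obtain a b where c: "s \<in> S" "m \<in> carrier M" "t \<in> S" "n \<in> carrier M"
    and ab: "a \<in> carrier R" "b \<in> carrier R" "a \<otimes> s \<in> S" "a \<otimes> s = b \<otimes> t"
    and eq: "a \<odot>\<^bsub>M\<^esub> m = b \<odot>\<^bsub>M\<^esub> n"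
    unfolding frac_rel_def by blast
  have "u \<odot>\<^bsub>M\<^esub> m = v \<odot>\<^bsub>M\<^esub> n"
    if uv: "u \<in> carrier R" "v \<in> carrier R" and e: "u \<otimes> s = v \<otimes> t" for u v
  proof -
    \<comment> \<open>The Ore condition compares the tested expansion \<open>u \<otimes> s\<close>
      with the given one \<open>a \<otimes> s\<close>. Cancelling \<open>s\<close> and
      \<open>t\<close> on the right gives \<open>g \<otimes> u = h \<otimes> a\<close> and
      \<open>g \<otimes> v = h \<otimes> b\<close>, so the required equation holds after
      multiplication by \<open>g\<close>, which torsion-freeness removes.\<close>
    obtain g h where gh: "g \<in> S" "h \<in> carrier R" "g \<otimes> (u \<otimes> s) = h \<otimes> (a \<otimes> s)"
      using Ore_obtain[of "u \<otimes> s" "a \<otimes> s"] uv ab c by auto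
    have "(g \<otimes> u) \<otimes> s = (h \<otimes> a) \<otimes> s"
      using gh uv ab c by (simp add: m_assoc)
    then have gu: "g \<otimes> u = h \<otimes> a"
      by (rule S_right_cancel[rotated 3]) (use c gh uv ab in auto)
    have "(g \<otimes> v) \<otimes> t = (h \<otimes> b) \<otimes> t"
      using gh uv ab c e by (simp add: m_assoc)
    then have gv: "g \<otimes> v = h \<otimes> b"
      by (rule S_right_cancel[rotated 3]) (use c gh uv ab in auto)
    have "g \<odot>\<^bsub>M\<^esub> (u \<odot>\<^bsub>M\<^esub> m) = (h \<otimes> a) \<odot>\<^bsub>M\<^esub> m"
      using gh uv c by (simp add: smult_assoc[symmetric] gu)
    also have "\<dots> = (h \<otimes> b) \<odot>\<^bsub>M\<^esub> n"
      using gh ab c eq by (simp add: smult_assoc)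
    also have "\<dots> = g \<odot>\<^bsub>M\<^esub> (v \<odot>\<^bsub>M\<^esub> n)"
      using gh uv c by (simp add: smult_assoc[symmetric] gv)
    finally show ?thesis by (rule torsionfree[rotated 3]) (use gh uv c in auto)
  qed
  then show ?R using c by blast
next
  assume R: ?R
  then obtain c a where "c \<in> S" "a \<in> carrier R" "c \<otimes> s = a \<otimes> t"
    using Ore_obtain[of s t] by auto
  then show ?L using R unfolding frac_rel_def by blast
qed

lemma equiv_frac_rel: "equiv (S \<times> carrier M) (frac_rel R S M)"
proof (rule equivI)
  show "frac_rel R S M \<subseteq> (S \<times> carrier M) \<times> (S \<times> carrier M)"
    unfolding frac_rel_def by blast
  show "refl_on (S \<times> carrier M) (frac_rel R S M)"
    by (auto simp: refl_on_def frac_rel_iff dest: S_right_cancel)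
  show "sym (frac_rel R S M)"
    by (auto simp: sym_def frac_rel_iff)
  show "trans (frac_rel R S M)"
  proof (rule transI, clarify)
    fix s m t n k l
    assume st: "((s, m), (t, n)) \<in> frac_rel R S M" and tk: "((t, n), (k, l)) \<in> frac_rel R S M"
    then have c: "s \<in> S" "m \<in> carrier M" "t \<in> S" "n \<in> carrier M" "k \<in> S" "l \<in> carrier M"
      by (simp_all add: frac_rel_iff)
    have "u \<odot>\<^bsub>M\<^esub> m = w \<odot>\<^bsub>M\<^esub> l"
      if uw: "u \<in> carrier R" "w \<in> carrier R" and e: "u \<otimes> s = w \<otimes> k" for u w
    proof -
      \<comment> \<open>Multiplying by \<open>g\<close> moves \<open>u \<otimes> s\<close> into the
        multiples of the middle denominator \<open>t\<close>; both relations can then be tested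
        against the same coefficient \<open>a\<close>.\<close>
      obtain g a where ga: "g \<in> S" "a \<in> carrier R" "g \<otimes> (u \<otimes> s) = a \<otimes> t"
        using Ore_obtain[of "u \<otimes> s" t] uw c by auto
      have "(g \<otimes> u) \<otimes> s = a \<otimes> t" "a \<otimes> t = (g \<otimes> w) \<otimes> k"
        using ga uw c e by (simp_all add: m_assoc)
      then have "(g \<otimes> u) \<odot>\<^bsub>M\<^esub> m = a \<odot>\<^bsub>M\<^esub> n" "a \<odot>\<^bsub>M\<^esub> n = (g \<otimes> w) \<odot>\<^bsub>M\<^esub> l"
        using st tk ga uw by (auto simp: frac_rel_iff)
      then have "g \<odot>\<^bsub>M\<^esub> (u \<odot>\<^bsub>M\<^esub> m) = g \<odot>\<^bsub>M\<^esub> (w \<odot>\<^bsub>M\<^esub> l)"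
        using ga uw c by (simp add: smult_assoc)
      then show ?thesis by (rule torsionfree[rotated 3]) (use ga uw c in auto)
    qed
    then show "((s, m), (k, l)) \<in> frac_rel R S M"
      using c by (simp add: frac_rel_iff)
  qed
qed

lemma frac_eq_iff:
  assumes "s \<in> S" "m \<in> carrier M" "t \<in> S" "n \<in> carrier M"
  shows "frac s m = frac t n \<longleftrightarrow>
    (\<forall>u\<in>carrier R. \<forall>v\<in>carrier R. u \<otimes> s = v \<otimes> t \<longrightarrow> u \<odot>\<^bsub>M\<^esub> m = v \<odot>\<^bsub>M\<^esub> n)"
  using eq_equiv_class_iff[OF equiv_frac_rel, of "(s, m)" "(t, n)"] assms
  by (simp add: left_frac_def frac_rel_iff)

lemma frac_eq_same:
  assumes "s \<in> S" "m \<in> carrier M" "n \<in> carrier M"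
  shows "frac s m = frac s n \<longleftrightarrow> m = n"
proof
  assume "frac s m = frac s n"
  then have "\<one> \<odot>\<^bsub>M\<^esub> m = \<one> \<odot>\<^bsub>M\<^esub> n" using assms by (simp add: frac_eq_iff del: smult_one)
  then show "m = n" using assms by simp
qed simp

text \<open>Right cancellation of \<open>s\<close> turns
  \<open>u \<otimes> (a \<otimes> s) = v \<otimes> s\<close> into \<open>u \<otimes> a = v\<close>.
  Only the product \<open>a \<otimes> s\<close> must be in \<open>S\<close>, not \<open>a\<close>,
  so a common multiple \<open>c \<otimes> s = a \<otimes> t\<close> from the Ore condition expands
  both fractions.\<close>

lemma frac_expand:
  assumes "a \<in> carrier R" "s \<in> S" "a \<otimes> s \<in> S" "m \<in> carrier M"
  shows "frac (a \<otimes> s) (a \<odot>\<^bsub>M\<^esub> m) = frac s m"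
proof -
  have "u \<odot>\<^bsub>M\<^esub> (a \<odot>\<^bsub>M\<^esub> m) = v \<odot>\<^bsub>M\<^esub> m"
    if "u \<in> carrier R" "v \<in> carrier R" "u \<otimes> (a \<otimes> s) = v \<otimes> s" for u v
  proof -
    have "u \<otimes> a = v" using S_right_cancel[of s "u \<otimes> a" v] that assms by (simp add: m_assoc)
    then show ?thesis using that assms by (simp add: smult_assoc[symmetric])
  qed
  then show ?thesis using assms by (simp add: frac_eq_iff)
qed

lemma frac_eq_zero_iff:
  assumes "s \<in> S" "m \<in> carrier M"
  shows "frac s m = frac \<one> \<zero>\<^bsub>M\<^esub> \<longleftrightarrow> m = \<zero>\<^bsub>M\<^esub>"
proof -
  interpret M: abelian_group M by (rule M_group)
  have z: "a \<odot>\<^bsub>M\<^esub> \<zero>\<^bsub>M\<^esub> = \<zero>\<^bsub>M\<^esub>" if "a \<in> carrier R" for a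
    using smult_r_distr[OF that, of "\<zero>\<^bsub>M\<^esub>" "\<zero>\<^bsub>M\<^esub>"] that by simp
  have "frac \<one> \<zero>\<^bsub>M\<^esub> = frac s \<zero>\<^bsub>M\<^esub>"
    using frac_expand[of s \<one> "\<zero>\<^bsub>M\<^esub>"] assms z by simp
  then show ?thesis using frac_eq_same assms by simp
qed

lemma mem_frac_iff:
  assumes "s \<in> S" "m \<in> carrier M"
  shows "(t, n) \<in> frac s m \<longleftrightarrow> t \<in> S \<and> n \<in> carrier M \<and>
    (\<forall>u\<in>carrier R. \<forall>v\<in>carrier R. u \<otimes> s = v \<otimes> t \<longrightarrow> u \<odot>\<^bsub>M\<^esub> m = v \<odot>\<^bsub>M\<^esub> n)"
  using assms by (simp add: left_frac_def frac_rel_iff)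

lemma frac_self: "s \<in> S \<Longrightarrow> m \<in> carrier M \<Longrightarrow> (s, m) \<in> frac s m"
  by (auto simp: mem_frac_iff dest: S_right_cancel)

text \<open>If \<open>u \<otimes> (c' \<otimes> s') = v \<otimes> (c \<otimes> s)\<close> for
  another choice of representatives and coefficients, the two given classes force the corresponding
  multiples of \<open>m\<close>, \<open>m'\<close> and of \<open>n\<close>, \<open>n'\<close> to
  agree; adding these equations shows that the choice does not matter.\<close>

lemma frac_add_eq:
  assumes s: "s \<in> S" "m \<in> carrier M" and t: "t \<in> S" "n \<in> carrier M"
    and cd: "c \<in> carrier R" "d \<in> carrier R" "c \<otimes> s \<in> S" "c \<otimes> s = d \<otimes> t"
  shows "frac_add R S M (frac s m) (frac t n) = frac (c \<otimes> s) (c \<odot>\<^bsub>M\<^esub> m \<oplus>\<^bsub>M\<^esub> d \<odot>\<^bsub>M\<^esub> n)"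
proof -
  interpret M: abelian_group M by (rule M_group)
  let ?x = "frac (c \<otimes> s) (c \<odot>\<^bsub>M\<^esub> m \<oplus>\<^bsub>M\<^esub> d \<odot>\<^bsub>M\<^esub> n)"
  have "frac (c' \<otimes> s') (c' \<odot>\<^bsub>M\<^esub> m' \<oplus>\<^bsub>M\<^esub> d' \<odot>\<^bsub>M\<^esub> n') = ?x"
    if s': "(s', m') \<in> frac s m" and t': "(t', n') \<in> frac t n"
      and c': "c' \<in> carrier R" "d' \<in> carrier R" "c' \<otimes> s' \<in> S" "c' \<otimes> s' = d' \<otimes> t'"
    for s' m' t' n' c' d'
  proof -
    have k: "s' \<in> S" "m' \<in> carrier M" "t' \<in> S" "n' \<in> carrier M"
      using s' t' s t by (simp_all add: mem_frac_iff)
    have "u \<odot>\<^bsub>M\<^esub> (c' \<odot>\<^bsub>M\<^esub> m' \<oplus>\<^bsub>M\<^esub> d' \<odot>\<^bsub>M\<^esub> n') = v \<odot>\<^bsub>M\<^esub> (c \<odot>\<^bsub>M\<^esub> m \<oplus>\<^bsub>M\<^esub> d \<odot>\<^bsub>M\<^esub> n)"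
      if uv: "u \<in> carrier R" "v \<in> carrier R" and e: "u \<otimes> (c' \<otimes> s') = v \<otimes> (c \<otimes> s)" for u v
    proof -
      have "(v \<otimes> c) \<otimes> s = (u \<otimes> c') \<otimes> s'"
        using e uv c' cd k s by (simp add: m_assoc)
      then have 1: "(v \<otimes> c) \<odot>\<^bsub>M\<^esub> m = (u \<otimes> c') \<odot>\<^bsub>M\<^esub> m'"
        using s' uv c' cd s by (simp add: mem_frac_iff)
      have "(v \<otimes> d) \<otimes> t = (u \<otimes> d') \<otimes> t'"
        using e uv c' cd k t by (simp add: m_assoc)
      then have 2: "(v \<otimes> d) \<odot>\<^bsub>M\<^esub> n = (u \<otimes> d') \<odot>\<^bsub>M\<^esub> n'"
        using t' uv c' cd t by (simp add: mem_frac_iff)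
      show ?thesis
        using 1 2 uv c' cd k s t by (simp add: smult_r_distr smult_assoc)
    qed
    then show ?thesis using c' cd k s t by (simp add: frac_eq_iff)
  qed
  moreover have "(s, m) \<in> frac s m" "(t, n) \<in> frac t n"
    using s t by (simp_all add: frac_self)
  ultimately show ?thesis
    unfolding frac_add_def using cd by (intro Union_eq_memberI) blast+
qed

lemma frac_add_same:
  assumes "s \<in> S" "m \<in> carrier M" "n \<in> carrier M"
  shows "frac_add R S M (frac s m) (frac s n) = frac s (m \<oplus>\<^bsub>M\<^esub> n)"
  using frac_add_eq[of s m s n \<one> \<one>] assms by simp

text \<open>Independence of the choices is a chain: equal denominators give
  \<open>(v \<otimes> c) \<otimes> r = (u \<otimes> c') \<otimes> r'\<close> by the first class,
  hence \<open>(v \<otimes> a) \<otimes> t = (u \<otimes> a') \<otimes> t'\<close> by the Ore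
  equations, and the second class yields equal numerators.\<close>

lemma frac_smult_eq:
  assumes s: "s \<in> S" "r \<in> carrier R" and t: "t \<in> S" "m \<in> carrier M"
    and ca: "c \<in> S" "a \<in> carrier R" "c \<otimes> r = a \<otimes> t"
  shows "frac_smult R S M (ring_frac R S s r) (frac t m) = frac (c \<otimes> s) (a \<odot>\<^bsub>M\<^esub> m)"
proof -
  interpret reg: torsionfree_module R S "regular_module R"
    by (rule torsionfree_regular_module)
  let ?x = "frac (c \<otimes> s) (a \<odot>\<^bsub>M\<^esub> m)"
  have "frac (c' \<otimes> s') (a' \<odot>\<^bsub>M\<^esub> m') = ?x"
    if s': "(s', r') \<in> ring_frac R S s r" and t': "(t', m') \<in> frac t m"
      and ca': "c' \<in> S" "a' \<in> carrier R" "c' \<otimes> r' = a' \<otimes> t'"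
    for s' r' t' m' c' a'
  proof -
    have k: "s' \<in> S" "r' \<in> carrier R" "t' \<in> S" "m' \<in> carrier M"
      using s' t' s t by (simp_all add: mem_frac_iff reg.mem_frac_iff)
    have "u \<odot>\<^bsub>M\<^esub> (a' \<odot>\<^bsub>M\<^esub> m') = v \<odot>\<^bsub>M\<^esub> (a \<odot>\<^bsub>M\<^esub> m)"
      if uv: "u \<in> carrier R" "v \<in> carrier R" and e: "u \<otimes> (c' \<otimes> s') = v \<otimes> (c \<otimes> s)" for u v
    proof -
      have "(v \<otimes> c) \<otimes> s = (u \<otimes> c') \<otimes> s'"
        using e uv ca' ca k s by (simp add: m_assoc)
      then have "(v \<otimes> c) \<otimes> r = (u \<otimes> c') \<otimes> r'"
        using s' uv ca' ca s by (simp add: reg.mem_frac_iff)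
      then have "(v \<otimes> a) \<otimes> t = (u \<otimes> a') \<otimes> t'"
        using uv ca' ca k s t by (simp add: m_assoc)
      then have "(v \<otimes> a) \<odot>\<^bsub>M\<^esub> m = (u \<otimes> a') \<odot>\<^bsub>M\<^esub> m'"
        using t' uv ca' ca t by (simp add: mem_frac_iff)
      then show ?thesis
        using uv ca' ca k t by (simp add: smult_assoc)
    qed
    then show ?thesis using ca' ca k s t by (simp add: frac_eq_iff S_mult smult_closed)
  qed
  moreover have "(s, r) \<in> ring_frac R S s r" "(t, m) \<in> frac t m"
    using s t by (simp_all add: frac_self reg.frac_self)
  ultimately show ?thesis
    unfolding frac_smult_def
    using ca by (intro Union_eq_memberI) blast+
qed

text \<open>The case \<open>c = \<one>\<close>. Later products are all computed in this form: once
  the numerator on the left ends in the denominator on the right, no further Ore step is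
  needed.\<close>

lemma frac_smult_cancel:
  assumes "s \<in> S" "a \<in> carrier R" "t \<in> S" "m \<in> carrier M"
  shows "frac_smult R S M (ring_frac R S s (a \<otimes> t)) (frac t m) = frac s (a \<odot>\<^bsub>M\<^esub> m)"
  using frac_smult_eq[of s "a \<otimes> t" t m \<one> a] assms by simp

end

section \<open>The ring of left fractions\<close>

lemma left_loc_simps [simp]:
  "\<one>\<^bsub>left_loc R S\<^esub> = ring_frac R S \<one>\<^bsub>R\<^esub> \<one>\<^bsub>R\<^esub>"
  "\<zero>\<^bsub>left_loc R S\<^esub> = ring_frac R S \<one>\<^bsub>R\<^esub> \<zero>\<^bsub>R\<^esub>"
  "X \<otimes>\<^bsub>left_loc R S\<^esub> Y = frac_smult R S (regular_module R) X Y"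
  "X \<oplus>\<^bsub>left_loc R S\<^esub> Y = frac_add R S (regular_module R) X Y"
  by (simp_all add: left_loc_def)

context torsionfree_module
begin

lemma common_denominator:
  assumes "s \<in> S" "m \<in> carrier M" "t \<in> S" "n \<in> carrier M"
  obtains u m' n' where "u \<in> S" "m' \<in> carrier M" "n' \<in> carrier M"
    "frac s m = frac u m'" "frac t n = frac u n'"
proof -
  obtain c a where ca: "c \<in> S" "a \<in> carrier R" "c \<otimes> s = a \<otimes> t"
    using Ore_obtain[of s t] assms by auto
  have u: "c \<otimes> s \<in> S" using S_mult[OF ca(1) assms(1)] .
  have "frac s m = frac (c \<otimes> s) (c \<odot>\<^bsub>M\<^esub> m)"
    using frac_expand[of c s m] assms ca u by auto
  moreover have "frac t n = frac (c \<otimes> s) (a \<odot>\<^bsub>M\<^esub> n)"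
    using frac_expand[of a t n] assms ca(2) u unfolding ca(3) by simp
  ultimately show ?thesis
    using that[of "c \<otimes> s" "c \<odot>\<^bsub>M\<^esub> m" "a \<odot>\<^bsub>M\<^esub> n"] u assms ca(1,2) by simp
qed

end

context regular_left_Ore
begin

interpretation reg: torsionfree_module R S "regular_module R"
  by (rule torsionfree_regular_module)

lemma ring_frac_closed [simp, intro]:
  "s \<in> S \<Longrightarrow> r \<in> carrier R \<Longrightarrow> ring_frac R S s r \<in> carrier (left_loc R S)"
  by (auto simp: left_loc_def)

lemma left_locE:
  assumes "x \<in> carrier (left_loc R S)"
  obtains s r where "s \<in> S" "r \<in> carrier R" "x = ring_frac R S s r"
  using assms by (auto simp: left_loc_def)

text \<open>Expanding by an Ore multiplier \<open>c\<close> with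
  \<open>c \<otimes> r = a \<otimes> t\<close> brings a fraction into the shape required by
  \<open>ring_frac_mult\<close>.\<close>

lemma ring_frac_factor:
  assumes "s \<in> S" "r \<in> carrier R" "t \<in> S"
  obtains u a where "u \<in> S" "a \<in> carrier R" "ring_frac R S s r = ring_frac R S u (a \<otimes> t)"
proof -
  obtain c a where ca: "c \<in> S" "a \<in> carrier R" "c \<otimes> r = a \<otimes> t"
    using Ore_obtain assms by metis
  have "ring_frac R S s r = ring_frac R S (c \<otimes> s) (c \<otimes> r)"
    using reg.frac_expand[of c s r] assms ca by auto
  then show ?thesis using that[of "c \<otimes> s" a] ca assms by auto
qed

lemma ring_frac_mult:
  assumes "s \<in> S" "a \<in> carrier R" "t \<in> S" "r \<in> carrier R"
  shows "ring_frac R S s (a \<otimes> t) \<otimes>\<^bsub>left_loc R S\<^esub> ring_frac R S t r = ring_frac R S s (a \<otimes> r)"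
  using reg.frac_smult_cancel[of s a t r] assms by simp

lemma ring_frac_add:
  assumes "s \<in> S" "a \<in> carrier R" "b \<in> carrier R"
  shows "ring_frac R S s a \<oplus>\<^bsub>left_loc R S\<^esub> ring_frac R S s b = ring_frac R S s (a \<oplus> b)"
  using reg.frac_add_same[of s a b] assms by simp

lemma ring_frac_eq_zero_iff:
  assumes "s \<in> S" "r \<in> carrier R"
  shows "ring_frac R S s r = \<zero>\<^bsub>left_loc R S\<^esub> \<longleftrightarrow> r = \<zero>"
  using reg.frac_eq_zero_iff[of s r] assms by simp

lemma ring_frac_self:
  assumes "s \<in> S"
  shows "ring_frac R S s s = \<one>\<^bsub>left_loc R S\<^esub>"
  using reg.frac_expand[of s \<one> \<one>] assms by simp

lemma left_loc_common2:
  assumes "x \<in> carrier (left_loc R S)" "y \<in> carrier (left_loc R S)"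
  obtains s a b where "s \<in> S" "a \<in> carrier R" "b \<in> carrier R"
    "x = ring_frac R S s a" "y = ring_frac R S s b"
proof -
  obtain s a t b where x: "s \<in> S" "a \<in> carrier R" "x = ring_frac R S s a"
    and y: "t \<in> S" "b \<in> carrier R" "y = ring_frac R S t b"
    using assms by (elim left_locE) blast
  then show ?thesis
    using reg.common_denominator[of s a t b] that by auto
qed

lemma left_loc_common3:
  assumes "x \<in> carrier (left_loc R S)" "y \<in> carrier (left_loc R S)" "z \<in> carrier (left_loc R S)"
  obtains s a b c where "s \<in> S" "a \<in> carrier R" "b \<in> carrier R" "c \<in> carrier R"
    "x = ring_frac R S s a" "y = ring_frac R S s b" "z = ring_frac R S s c"
proof -
  obtain s a b where xy: "s \<in> S" "a \<in> carrier R" "b \<in> carrier R"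
    "x = ring_frac R S s a" "y = ring_frac R S s b"
    using assms left_loc_common2 by metis
  obtain t c where z: "t \<in> S" "c \<in> carrier R" "z = ring_frac R S t c"
    using assms left_locE by metis
  obtain g h where gh: "g \<in> S" "h \<in> carrier R" "g \<otimes> s = h \<otimes> t"
    using Ore_obtain[of s t] xy z by auto
  have u: "g \<otimes> s \<in> S" using S_mult[OF gh(1) xy(1)] .
  have "x = ring_frac R S (g \<otimes> s) (g \<otimes> a)" "y = ring_frac R S (g \<otimes> s) (g \<otimes> b)"
    using reg.frac_expand[of g s] xy gh u by auto
  moreover have "z = ring_frac R S (g \<otimes> s) (h \<otimes> c)"
    using reg.frac_expand[of h t c] z gh(2) u unfolding gh(3) by simp
  ultimately show ?thesis
    using that[of "g \<otimes> s" "g \<otimes> a" "g \<otimes> b" "h \<otimes> c"] u gh(1,2) xy(1-3) z(2) by simp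
qed

lemma left_loc_mult_form:
  assumes "x \<in> carrier (left_loc R S)" "t \<in> S"
  obtains s a where "s \<in> S" "a \<in> carrier R" "x = ring_frac R S s (a \<otimes> t)"
  using assms by (metis left_locE ring_frac_factor)

lemma left_loc_closed:
  assumes "x \<in> carrier (left_loc R S)" "y \<in> carrier (left_loc R S)"
  shows "x \<oplus>\<^bsub>left_loc R S\<^esub> y \<in> carrier (left_loc R S)"
    and "x \<otimes>\<^bsub>left_loc R S\<^esub> y \<in> carrier (left_loc R S)"
proof -
  obtain s a b where "s \<in> S" "a \<in> carrier R" "b \<in> carrier R"
    "x = ring_frac R S s a" "y = ring_frac R S s b"
    using assms left_loc_common2 by metis
  then show "x \<oplus>\<^bsub>left_loc R S\<^esub> y \<in> carrier (left_loc R S)"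
    by (simp add: ring_frac_add del: left_loc_simps)
next
  obtain t b where y: "t \<in> S" "b \<in> carrier R" "y = ring_frac R S t b"
    using assms left_locE by metis
  moreover obtain s a where "s \<in> S" "a \<in> carrier R" "x = ring_frac R S s (a \<otimes> t)"
    using assms y left_loc_mult_form by metis
  ultimately show "x \<otimes>\<^bsub>left_loc R S\<^esub> y \<in> carrier (left_loc R S)"
    by (simp add: ring_frac_mult del: left_loc_simps)
qed

text \<open>Each axiom becomes an identity in \<open>R\<close> for well-chosen representatives:
  common denominators for sums, factored numerators for products.\<close>

theorem ring_left_loc: "ring (left_loc R S)"
proof (rule ringI)
  let ?L = "left_loc R S"
  \<comment> \<open>The operations stay folded so that \<open>ring_frac_add\<close> and
    \<open>ring_frac_mult\<close> apply to them.\<close>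
  note [simp del] = left_loc_simps(3,4)
  show "abelian_group ?L"
  proof (rule abelian_groupI)
    fix x y z assume x: "x \<in> carrier ?L" and y: "y \<in> carrier ?L" and z: "z \<in> carrier ?L"
    show "(x \<oplus>\<^bsub>?L\<^esub> y) \<oplus>\<^bsub>?L\<^esub> z = x \<oplus>\<^bsub>?L\<^esub> (y \<oplus>\<^bsub>?L\<^esub> z)"
      using left_loc_common3[OF x y z] by (metis ring_frac_add a_closed a_assoc)
  next
    fix x y assume x: "x \<in> carrier ?L" and y: "y \<in> carrier ?L"
    show "x \<oplus>\<^bsub>?L\<^esub> y = y \<oplus>\<^bsub>?L\<^esub> x"
      using left_loc_common2[OF x y] by (metis ring_frac_add a_comm)
  next
    fix x assume "x \<in> carrier ?L"
    then obtain s a where x: "s \<in> S" "a \<in> carrier R" "x = ring_frac R S s a"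
      by (rule left_locE)
    have z: "\<zero>\<^bsub>?L\<^esub> = ring_frac R S s \<zero>"
      using ring_frac_eq_zero_iff[of s \<zero>] x by simp
    show "\<zero>\<^bsub>?L\<^esub> \<oplus>\<^bsub>?L\<^esub> x = x"
      unfolding z using x by (simp add: ring_frac_add)
    show "\<exists>y\<in>carrier ?L. y \<oplus>\<^bsub>?L\<^esub> x = \<zero>\<^bsub>?L\<^esub>"
      unfolding z using x
      by (intro bexI[of _ "ring_frac R S s (\<ominus> a)"]) (simp_all add: ring_frac_add l_neg)
  qed (auto intro: left_loc_closed)
  show "monoid ?L"
  proof (rule monoidI)
    fix x y z assume x: "x \<in> carrier ?L" and y: "y \<in> carrier ?L" and z: "z \<in> carrier ?L"
    \<comment> \<open>Representatives are chosen from right to left, each numerator absorbing the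
      denominator of the factor that follows it.\<close>
    obtain u c where z': "u \<in> S" "c \<in> carrier R" "z = ring_frac R S u c"
      using z by (rule left_locE)
    obtain t b where y': "t \<in> S" "b \<in> carrier R" "y = ring_frac R S t (b \<otimes> u)"
      using y z'(1) by (rule left_loc_mult_form)
    obtain s a where x': "s \<in> S" "a \<in> carrier R" "x = ring_frac R S s (a \<otimes> t)"
      using x y'(1) by (rule left_loc_mult_form)
    have "x \<otimes>\<^bsub>?L\<^esub> y = ring_frac R S s ((a \<otimes> b) \<otimes> u)"
      using x' y' z' by (simp add: ring_frac_mult m_assoc)
    then show "(x \<otimes>\<^bsub>?L\<^esub> y) \<otimes>\<^bsub>?L\<^esub> z = x \<otimes>\<^bsub>?L\<^esub> (y \<otimes>\<^bsub>?L\<^esub> z)"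
      using x' y' z' ring_frac_mult[of s "a \<otimes> b" u c] ring_frac_mult[of s a t "b \<otimes> c"]
      by (simp add: ring_frac_mult m_assoc)
  next
    fix x assume "x \<in> carrier ?L"
    then obtain s a where x: "s \<in> S" "a \<in> carrier R" "x = ring_frac R S s a"
      by (rule left_locE)
    show "\<one>\<^bsub>?L\<^esub> \<otimes>\<^bsub>?L\<^esub> x = x"
      using ring_frac_mult[of s \<one> s a] ring_frac_self[of s] x by simp
    show "x \<otimes>\<^bsub>?L\<^esub> \<one>\<^bsub>?L\<^esub> = x"
      using ring_frac_mult[of s a \<one> \<one>] x by simp
  qed (auto intro: left_loc_closed)
next
  let ?L = "left_loc R S"
  note [simp del] = left_loc_simps(3,4)
  fix x y z assume x: "x \<in> carrier ?L" and y: "y \<in> carrier ?L" and z: "z \<in> carrier ?L"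
  obtain t c where z': "t \<in> S" "c \<in> carrier R" "z = ring_frac R S t c"
    using z by (rule left_locE)
  obtain s a b where xy: "s \<in> S" "a \<in> carrier R" "b \<in> carrier R"
    "x = ring_frac R S s a" "y = ring_frac R S s b"
    using x y by (rule left_loc_common2)
  \<comment> \<open>Over one denominator, both numerators must become right multiples of
    \<open>t\<close>: \<open>g\<close> achieves this for \<open>a\<close>, then \<open>h\<close> for
    \<open>g \<otimes> b\<close>, and both fractions are expanded by
    \<open>h \<otimes> g\<close>.\<close>
  obtain g a' where g: "g \<in> S" "a' \<in> carrier R" "g \<otimes> a = a' \<otimes> t"
    using Ore_obtain xy z' by metis
  obtain h b' where h: "h \<in> S" "b' \<in> carrier R" "h \<otimes> (g \<otimes> b) = b' \<otimes> t"
    using Ore_obtain[of "g \<otimes> b" t] xy z' g by auto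
  let ?s = "(h \<otimes> g) \<otimes> s"
  have k: "?s \<in> S" "h \<otimes> g \<in> S" using h g xy by auto
  have "x = ring_frac R S ?s ((h \<otimes> g) \<otimes> a)"
    using reg.frac_expand[of "h \<otimes> g" s a] k xy by auto
  also have "(h \<otimes> g) \<otimes> a = (h \<otimes> a') \<otimes> t"
    using h g xy z' by (simp add: m_assoc)
  finally have x': "x = ring_frac R S ?s ((h \<otimes> a') \<otimes> t)" .
  have "y = ring_frac R S ?s ((h \<otimes> g) \<otimes> b)"
    using reg.frac_expand[of "h \<otimes> g" s b] k xy by auto
  also have "(h \<otimes> g) \<otimes> b = b' \<otimes> t"
    using h g xy z' by (simp add: m_assoc)
  finally have y': "y = ring_frac R S ?s (b' \<otimes> t)" .
  have "x \<oplus>\<^bsub>?L\<^esub> y = ring_frac R S ?s ((h \<otimes> a' \<oplus> b') \<otimes> t)"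
    unfolding x' y' using k h g z' by (simp add: ring_frac_add l_distr)
  then have "(x \<oplus>\<^bsub>?L\<^esub> y) \<otimes>\<^bsub>?L\<^esub> z = ring_frac R S ?s ((h \<otimes> a' \<oplus> b') \<otimes> c)"
    using k h g z' by (simp add: ring_frac_mult)
  also have "\<dots> = x \<otimes>\<^bsub>?L\<^esub> z \<oplus>\<^bsub>?L\<^esub> y \<otimes>\<^bsub>?L\<^esub> z"
    unfolding x' y' using k h g z' by (simp add: ring_frac_mult ring_frac_add l_distr)
  finally show "(x \<oplus>\<^bsub>?L\<^esub> y) \<otimes>\<^bsub>?L\<^esub> z = x \<otimes>\<^bsub>?L\<^esub> z \<oplus>\<^bsub>?L\<^esub> y \<otimes>\<^bsub>?L\<^esub> z" .
next
  let ?L = "left_loc R S"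
  note [simp del] = left_loc_simps(3,4)
  fix x y z assume x: "x \<in> carrier ?L" and y: "y \<in> carrier ?L" and z: "z \<in> carrier ?L"
  obtain t b c where yz: "t \<in> S" "b \<in> carrier R" "c \<in> carrier R"
    "x = ring_frac R S t b" "y = ring_frac R S t c"
    using x y by (rule left_loc_common2)
  obtain s a where "s \<in> S" "a \<in> carrier R" "z = ring_frac R S s (a \<otimes> t)"
    using z yz(1) by (rule left_loc_mult_form)
  with yz show "z \<otimes>\<^bsub>?L\<^esub> (x \<oplus>\<^bsub>?L\<^esub> y) = z \<otimes>\<^bsub>?L\<^esub> x \<oplus>\<^bsub>?L\<^esub> z \<otimes>\<^bsub>?L\<^esub> y"
    by (simp add: ring_frac_mult ring_frac_add r_distr)
qed

end

section \<open>Localization of quotients\<close>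

text \<open>Choosing any preimage under \<open>k\<close> is harmless because \<open>l\<close> is
  constant on the fibres of \<open>k\<close>. This is how formulas on pairs or on ring elements
  define maps on fractions and on cosets.\<close>

lemma factor_through:
  assumes "\<And>x y. \<lbrakk> x \<in> A; y \<in> A; k x = k y \<rbrakk> \<Longrightarrow> l x = l y"
  shows "\<exists>f. \<forall>x\<in>A. f (k x) = l x"
proof (intro exI[of _ "l \<circ> inv_into A k"] ballI)
  fix x assume "x \<in> A"
  then have "l (inv_into A k (k x)) = l x"
    by (intro assms) (simp_all add: inv_into_into f_inv_into_f)
  then show "(l \<circ> inv_into A k) (k x) = l x" by simp
qed

context regular_left_Ore
begin

interpretation reg: torsionfree_module R S "regular_module R"
  by (rule torsionfree_regular_module)

text \<open>Here \<open>c\<close> itself lies in \<open>S\<close>: homomorphic images of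
  \<open>c \<otimes> s\<close> then remain denominators, and a saturation hypothesis can cancel
  \<open>c\<close>.\<close>

lemma ring_frac_eqE:
  assumes "s \<in> S" "r \<in> carrier R" "t \<in> S" "q \<in> carrier R" "ring_frac R S s r = ring_frac R S t q"
  obtains c a where "c \<in> S" "a \<in> carrier R" "c \<otimes> s = a \<otimes> t" "c \<otimes> r = a \<otimes> q"
proof -
  obtain c a where ca: "c \<in> S" "a \<in> carrier R" "c \<otimes> s = a \<otimes> t"
    using Ore_obtain[of s t] assms by auto
  moreover have "\<forall>u\<in>carrier R. \<forall>v\<in>carrier R. u \<otimes> s = v \<otimes> t \<longrightarrow> u \<otimes> r = v \<otimes> q"
    using reg.frac_eq_iff[of s r t q] assms by simp
  then have "c \<otimes> r = a \<otimes> q" using ca by (meson S_closed)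
  ultimately show ?thesis by (rule that)
qed

text \<open>A common expansion of two equal fractions is mapped by \<open>h\<close> to a common
  expansion of their images, so the induced map is well defined. \<open>S'\<close> may be larger
  than the image of \<open>S\<close>, as happens for the map into the largest left quotient ring of
  a quotient.\<close>

lemma left_loc_map:
  assumes R': "regular_left_Ore R' S'" and h: "h \<in> ring_hom R R'" and S': "h ` S \<subseteq> S'"
  obtains f where "f \<in> ring_hom (left_loc R S) (left_loc R' S')"
    "\<And>s r. \<lbrakk> s \<in> S; r \<in> carrier R \<rbrakk> \<Longrightarrow> f (ring_frac R S s r) = ring_frac R' S' (h s) (h r)"
proof -
  interpret R': regular_left_Ore R' S' by fact
  interpret reg': torsionfree_module R' S' "regular_module R'"
    by (rule R'.torsionfree_regular_module)
  have hc: "h a \<in> carrier R'" if "a \<in> carrier R" for a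
    using h that by (rule ring_hom_closed)
  have hS: "h s \<in> S'" if "s \<in> S" for s using S' that by blast
  have wd: "ring_frac R' S' (h s) (h r) = ring_frac R' S' (h t) (h q)"
    if 1: "s \<in> S" "r \<in> carrier R" "t \<in> S" "q \<in> carrier R"
      and eq: "ring_frac R S s r = ring_frac R S t q" for s r t q
  proof -
    obtain c a where ca: "c \<in> S" "a \<in> carrier R" "c \<otimes> s = a \<otimes> t" "c \<otimes> r = a \<otimes> q"
      using ring_frac_eqE[OF 1 eq] .
    have m: "h c \<otimes>\<^bsub>R'\<^esub> h s = h a \<otimes>\<^bsub>R'\<^esub> h t" "h c \<otimes>\<^bsub>R'\<^esub> h r = h a \<otimes>\<^bsub>R'\<^esub> h q"
      using arg_cong[OF ca(3), of h] arg_cong[OF ca(4), of h] ca(1,2) 1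
      by (simp_all add: ring_hom_mult[OF h])
    have u: "h c \<otimes>\<^bsub>R'\<^esub> h s \<in> S'" using R'.S_mult hS ca 1 by simp
    have "ring_frac R' S' (h s) (h r) = ring_frac R' S' (h c \<otimes>\<^bsub>R'\<^esub> h s) (h c \<otimes>\<^bsub>R'\<^esub> h r)"
      using reg'.frac_expand[of "h c" "h s" "h r"] u hS hc 1 ca by simp
    also have "\<dots> = ring_frac R' S' (h a \<otimes>\<^bsub>R'\<^esub> h t) (h a \<otimes>\<^bsub>R'\<^esub> h q)" by (simp only: m)
    also have "\<dots> = ring_frac R' S' (h t) (h q)"
      using reg'.frac_expand[of "h a" "h t" "h q"] u[unfolded m] hS hc 1 ca by simp
    finally show ?thesis .
  qed
  have "\<exists>f. \<forall>x\<in>S \<times> carrier R. f (case x of (s, r) \<Rightarrow> ring_frac R S s r) =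
      (case x of (s, r) \<Rightarrow> ring_frac R' S' (h s) (h r))"
    by (rule factor_through) (clarsimp, rule wd, assumption+)
  then obtain f where F: "\<forall>x\<in>S \<times> carrier R. f (case x of (s, r) \<Rightarrow> ring_frac R S s r) =
      (case x of (s, r) \<Rightarrow> ring_frac R' S' (h s) (h r))" ..
  have f: "f (ring_frac R S s r) = ring_frac R' S' (h s) (h r)" if "s \<in> S" "r \<in> carrier R" for s r
    using F[rule_format, of "(s, r)"] that by simp
  note [simp del] = left_loc_simps(3,4)
  have "f \<in> ring_hom (left_loc R S) (left_loc R' S')"
  proof (rule ring_hom_memI)
    fix x assume "x \<in> carrier (left_loc R S)"
    then show "f x \<in> carrier (left_loc R' S')"
      by (elim left_locE) (simp add: f hS hc)
  next
    fix x y assume x: "x \<in> carrier (left_loc R S)" and y: "y \<in> carrier (left_loc R S)"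
    obtain t b where y': "t \<in> S" "b \<in> carrier R" "y = ring_frac R S t b"
      using y by (rule left_locE)
    obtain s a where x': "s \<in> S" "a \<in> carrier R" "x = ring_frac R S s (a \<otimes> t)"
      using x y'(1) by (rule left_loc_mult_form)
    show "f (x \<otimes>\<^bsub>left_loc R S\<^esub> y) = f x \<otimes>\<^bsub>left_loc R' S'\<^esub> f y"
      using x' y' by (simp add: ring_frac_mult f ring_hom_mult[OF h] R'.ring_frac_mult hS hc)
    obtain s a b where "s \<in> S" "a \<in> carrier R" "b \<in> carrier R"
      "x = ring_frac R S s a" "y = ring_frac R S s b"
      using x y by (rule left_loc_common2)
    then show "f (x \<oplus>\<^bsub>left_loc R S\<^esub> y) = f x \<oplus>\<^bsub>left_loc R' S'\<^esub> f y"
      by (simp add: ring_frac_add f ring_hom_add[OF h] R'.ring_frac_add hS hc)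
  next
    show "f \<one>\<^bsub>left_loc R S\<^esub> = \<one>\<^bsub>left_loc R' S'\<^esub>"
      by (simp add: f ring_hom_one[OF h])
  qed
  then show ?thesis using f by (rule that)
qed

end

section \<open>Quotients by two-sided ideals\<close>

lemma (in ideal) quot_map_eq_zero_iff:
  "x \<in> carrier R \<Longrightarrow> I +> x = \<zero>\<^bsub>R Quot I\<^esub> \<longleftrightarrow> x \<in> I"
  using rcos_const_imp_mem a_rcos_const by (auto simp: FactRing_def)

lemma (in ideal) quot_map_eq_iff:
  assumes "x \<in> carrier R" "y \<in> carrier R"
  shows "I +> x = I +> y \<longleftrightarrow> x \<ominus> y \<in> I"
proof -
  interpret pi: ring_hom_ring R "R Quot I" "(+>) I" by (rule rcos_ring_hom_ring)
  have "I +> (x \<ominus> y) = (I +> x) \<ominus>\<^bsub>R Quot I\<^esub> (I +> y)"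
    using assms by (simp add: a_minus_def)
  then have "x \<ominus> y \<in> I \<longleftrightarrow> (I +> x) \<ominus>\<^bsub>R Quot I\<^esub> (I +> y) = \<zero>\<^bsub>R Quot I\<^esub>"
    using quot_map_eq_zero_iff[of "x \<ominus> y"] assms by simp
  also have "\<dots> \<longleftrightarrow> I +> x = I +> y"
    using assms pi.S.eq_if_minus_eq_zero[of "I +> x" "I +> y"] by (auto simp: pi.S.r_neg a_minus_def)
  finally show ?thesis ..
qed

lemma carrier_Quot: "carrier (R Quot I) = {I +>\<^bsub>R\<^esub> x |x. x \<in> carrier R}"
  by (auto simp: FactRing_def A_RCOSETS_def')

text \<open>The first isomorphism theorem for a left module map from the regular module onto
  \<open>N\<close>. The two directions of \<open>ker\<close> give injectivity and well-definedness
  of the induced map.\<close>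

lemma (in ideal) quot_module_iso:
  assumes g: "g ` carrier R = carrier N"
    and add: "\<And>x y. \<lbrakk> x \<in> carrier R; y \<in> carrier R \<rbrakk> \<Longrightarrow> g (x \<oplus> y) = g x \<oplus>\<^bsub>N\<^esub> g y"
    and mult: "\<And>a x. \<lbrakk> a \<in> carrier R; x \<in> carrier R \<rbrakk> \<Longrightarrow> g (a \<otimes> x) = a \<odot>\<^bsub>N\<^esub> g x"
    and ker: "\<And>x y. \<lbrakk> x \<in> carrier R; y \<in> carrier R \<rbrakk> \<Longrightarrow> g x = g y \<longleftrightarrow> x \<ominus> y \<in> I"
  shows "left_module_iso R (quot_module R I) N \<noteq> {}"
proof -
  interpret pi: ring_hom_ring R "R Quot I" "(+>) I" by (rule rcos_ring_hom_ring)
  have "\<exists>h. \<forall>x\<in>carrier R. h (I +> x) = g x"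
    by (rule factor_through) (simp add: ker quot_map_eq_iff)
  then obtain h where h: "\<And>x. x \<in> carrier R \<Longrightarrow> h (I +> x) = g x" by blast
  have "h \<in> left_module_iso R (quot_module R I) N"
    unfolding left_module_iso_def
  proof (intro CollectI conjI ballI)
    show "bij_betw h (carrier (quot_module R I)) (carrier N)"
      unfolding bij_betw_def
    proof
      show "inj_on h (carrier (quot_module R I))"
        by (rule inj_onI) (clarsimp simp: carrier_Quot h ker quot_map_eq_iff)
      have "h ` carrier (quot_module R I) = (\<lambda>x. h (I +> x)) ` carrier R"
        by (auto simp: carrier_Quot)
      also have "\<dots> = g ` carrier R" using h by (rule image_cong[OF refl])
      finally show "h ` carrier (quot_module R I) = carrier N" using g by simp
    qed
    fix X assume "X \<in> carrier (quot_module R I)"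
    then obtain x where x: "x \<in> carrier R" "X = I +> x" by (auto simp: carrier_Quot)
    {
      fix Y assume "Y \<in> carrier (quot_module R I)"
      then obtain y where y: "y \<in> carrier R" "Y = I +> y" by (auto simp: carrier_Quot)
      show "h (X \<oplus>\<^bsub>quot_module R I\<^esub> Y) = h X \<oplus>\<^bsub>N\<^esub> h Y"
        using x y by (simp add: pi.hom_add[symmetric] h add del: pi.hom_add)
    }
    fix a assume "a \<in> carrier R"
    then show "h (a \<odot>\<^bsub>quot_module R I\<^esub> X) = a \<odot>\<^bsub>N\<^esub> h X"
      using x by (simp add: pi.hom_mult[symmetric] h mult del: pi.hom_mult)
  qed
  then show ?thesis by blast
qed

text \<open>The two saturation conditions say that \<open>S\<close> maps to regular elements of
  \<open>R Quot I\<close>. The minimal primes provide the instances, by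
  \<open>saturated_min_prime\<close>.\<close>

locale saturated_ideal = regular_left_Ore + ideal I R for I +
  assumes proper: "I \<noteq> carrier R"
    and left_saturated: "\<lbrakk> s \<in> S; r \<in> carrier R; s \<otimes> r \<in> I \<rbrakk> \<Longrightarrow> r \<in> I"
    and right_saturated: "\<lbrakk> s \<in> S; r \<in> carrier R; r \<otimes> s \<in> I \<rbrakk> \<Longrightarrow> r \<in> I"
begin

interpretation reg: torsionfree_module R S "regular_module R"
  by (rule torsionfree_regular_module)

interpretation pi: ring_hom_ring R "R Quot I" "(+>) I" by (rule rcos_ring_hom_ring)

lemma quot_one_not_zero: "\<one>\<^bsub>R Quot I\<^esub> \<noteq> \<zero>\<^bsub>R Quot I\<^esub>"
  using quot_map_eq_zero_iff[of \<one>] one_imp_carrier proper by auto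

lemma quot_image_regular: "quot_map R I ` S \<subseteq> regular_elements (R Quot I)"
proof (clarify, unfold regular_elements_def, intro CollectI conjI ballI impI)
  fix s assume s: "s \<in> S"
  then show "I +> s \<in> carrier (R Quot I)" by simp
  fix X assume "X \<in> carrier (R Quot I)"
  then obtain x where x: "x \<in> carrier R" "X = I +> x" by (auto simp: carrier_Quot)
  show "X = \<zero>\<^bsub>R Quot I\<^esub>" if "(I +> s) \<otimes>\<^bsub>R Quot I\<^esub> X = \<zero>\<^bsub>R Quot I\<^esub>"
  proof -
    have "s \<otimes> x \<in> I"
      using that x s quot_map_eq_zero_iff[of "s \<otimes> x"] by (simp add: pi.hom_mult[symmetric] del: pi.hom_mult)
    then have "x \<in> I" by (rule left_saturated[OF s x(1)])
    then show ?thesis using x quot_map_eq_zero_iff by simp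
  qed
  show "X = \<zero>\<^bsub>R Quot I\<^esub>" if "X \<otimes>\<^bsub>R Quot I\<^esub> (I +> s) = \<zero>\<^bsub>R Quot I\<^esub>"
  proof -
    have "x \<otimes> s \<in> I"
      using that x s quot_map_eq_zero_iff[of "x \<otimes> s"] by (simp add: pi.hom_mult[symmetric] del: pi.hom_mult)
    then have "x \<in> I" by (rule right_saturated[OF s x(1)])
    then show ?thesis using x quot_map_eq_zero_iff by simp
  qed
qed

lemma quot_regular_left_Ore: "regular_left_Ore (R Quot I) (quot_map R I ` S)"
proof (intro regular_left_Ore.intro regular_left_Ore_axioms.intro
    quot_image_regular pi.S.ring_axioms)
  let ?T = "quot_map R I ` S"
  \<comment> \<open>A regular zero would, on multiplying one to zero, force the quotient ring to be
    trivial.\<close>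
  have "\<zero>\<^bsub>R Quot I\<^esub> \<notin> ?T"
  proof
    assume "\<zero>\<^bsub>R Quot I\<^esub> \<in> ?T"
    then have "\<zero>\<^bsub>R Quot I\<^esub> \<in> regular_elements (R Quot I)"
      using quot_image_regular by blast
    then have "\<one>\<^bsub>R Quot I\<^esub> = \<zero>\<^bsub>R Quot I\<^esub>"
      unfolding regular_elements_def by simp
    with quot_one_not_zero show False ..
  qed
  moreover have "\<one>\<^bsub>R Quot I\<^esub> \<in> ?T" using pi.hom_one S_one by (metis imageI)
  moreover have "x \<otimes>\<^bsub>R Quot I\<^esub> y \<in> ?T" if "x \<in> ?T" "y \<in> ?T" for x y
    using that by (auto simp: pi.hom_mult[symmetric] simp del: pi.hom_mult)
  ultimately have "multiplicative_subset (R Quot I) ?T"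
    unfolding multiplicative_subset_def by auto
  moreover have "{t \<otimes>\<^bsub>R Quot I\<^esub> X |t. t \<in> ?T} \<inter> {a \<otimes>\<^bsub>R Quot I\<^esub> U |a. a \<in> carrier (R Quot I)} \<noteq> {}"
    if X: "X \<in> carrier (R Quot I)" and U: "U \<in> ?T" for X U
  proof -
    obtain x s where xs: "x \<in> carrier R" "X = I +> x" "s \<in> S" "U = I +> s"
      using X U by (auto simp: carrier_Quot)
    obtain c a where "c \<in> S" "a \<in> carrier R" "c \<otimes> x = a \<otimes> s"
      using Ore_obtain xs by metis
    then have "(I +> c) \<otimes>\<^bsub>R Quot I\<^esub> X = (I +> a) \<otimes>\<^bsub>R Quot I\<^esub> U"
      "I +> c \<in> ?T" "I +> a \<in> carrier (R Quot I)"
      using xs by (simp_all add: pi.hom_mult[symmetric] del: pi.hom_mult)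
    then show ?thesis by blast
  qed
  ultimately show "left_Ore_set (R Quot I) ?T"
    unfolding left_Ore_set_def by simp
qed

sublocale quot: regular_left_Ore "R Quot I" "quot_map R I ` S"
  by (rule quot_regular_left_Ore)

lemma quot_image_Den_l: "quot_map R I ` S \<in> Den_l (R Quot I) {\<zero>\<^bsub>R Quot I\<^esub>}"
proof -
  let ?T = "quot_map R I ` S"
  have "\<exists>t\<in>?T. t \<otimes>\<^bsub>R Quot I\<^esub> X = \<zero>\<^bsub>R Quot I\<^esub>"
    if "X \<in> carrier (R Quot I)" "U \<in> ?T" "X \<otimes>\<^bsub>R Quot I\<^esub> U = \<zero>\<^bsub>R Quot I\<^esub>" for X U
    using quot.S_right_regular[OF that(2,1,3)] quot.S_one pi.S.r_null pi.S.one_closed by blast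
  moreover have "{X \<in> carrier (R Quot I). \<exists>t\<in>?T. t \<otimes>\<^bsub>R Quot I\<^esub> X = \<zero>\<^bsub>R Quot I\<^esub>} = {\<zero>\<^bsub>R Quot I\<^esub>}"
    (is "?A = _")
  proof
    show "?A \<subseteq> {\<zero>\<^bsub>R Quot I\<^esub>}"
      using quot.S_left_regular by blast
    show "{\<zero>\<^bsub>R Quot I\<^esub>} \<subseteq> ?A"
      using quot.S_one pi.S.r_null pi.S.one_closed pi.S.zero_closed by blast
  qed
  ultimately show ?thesis
    unfolding Den_l_def left_denominator_set_def using quot.Ore by blast
qed

lemma quot_image_subset_S_l: "quot_map R I ` S \<subseteq> S_l (R Quot I)"
  using S_l_largest[OF pi.S.ring_axioms quot_one_not_zero] quot.Ore quot.reg
  unfolding is_largest_regular_left_Ore_set_def by blast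

text \<open>Membership can be read off from any representative: if s^-1 r = t^-1 q with
  \<open>q\<close> in \<open>I\<close>, then \<open>c \<otimes> r = a \<otimes> q\<close> is in
  \<open>I\<close> for some \<open>c\<close> in \<open>S\<close>, and left saturation cancels
  \<open>c\<close>.\<close>

lemma ring_frac_in_loc_ideal_iff:
  assumes "s \<in> S" "r \<in> carrier R"
  shows "ring_frac R S s r \<in> loc_ideal R S I \<longleftrightarrow> r \<in> I"
proof
  assume "ring_frac R S s r \<in> loc_ideal R S I"
  then obtain t q where t: "t \<in> S" "q \<in> I" "ring_frac R S s r = ring_frac R S t q"
    unfolding loc_ideal_def by blast
  then obtain c a where ca: "c \<in> S" "a \<in> carrier R" "c \<otimes> r = a \<otimes> q"
    using ring_frac_eqE[of s r t q] assms Icarr by metis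
  then have "c \<otimes> r \<in> I" using I_l_closed t by simp
  then show "r \<in> I" using left_saturated ca assms by blast
qed (use assms in \<open>auto simp: loc_ideal_def\<close>)

text \<open>A fraction is sent to zero exactly when its numerator lies in \<open>I\<close>, which
  determines the kernel. With \<open>T\<close> the image of \<open>S\<close> this yields the
  isomorphism of localizations, with \<open>T = S_l (R Quot I)\<close> the embedding in (c).\<close>

lemma left_loc_quot_map:
  assumes T: "regular_left_Ore (R Quot I) T" and sub: "quot_map R I ` S \<subseteq> T"
  obtains f where "ring_hom_ring (left_loc R S) (left_loc (R Quot I) T) f"
    "a_kernel (left_loc R S) (left_loc (R Quot I) T) f = loc_ideal R S I"
    "\<forall>s\<in>S. \<forall>r\<in>carrier R. f (ring_frac R S s r) = ring_frac (R Quot I) T (I +> s) (I +> r)"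
proof -
  interpret T: regular_left_Ore "R Quot I" T by fact
  obtain f where f: "f \<in> ring_hom (left_loc R S) (left_loc (R Quot I) T)"
    and eq: "\<And>s r. \<lbrakk> s \<in> S; r \<in> carrier R \<rbrakk> \<Longrightarrow>
      f (ring_frac R S s r) = ring_frac (R Quot I) T (I +> s) (I +> r)"
    using left_loc_map[OF T rcos_ring_hom sub] by blast
  have "f x = \<zero>\<^bsub>left_loc (R Quot I) T\<^esub> \<longleftrightarrow> x \<in> loc_ideal R S I" if "x \<in> carrier (left_loc R S)" for x
  proof -
    obtain s r where x: "s \<in> S" "r \<in> carrier R" "x = ring_frac R S s r"
      using \<open>x \<in> _\<close> by (rule left_locE)
    then have "f x = \<zero>\<^bsub>left_loc (R Quot I) T\<^esub> \<longleftrightarrow> r \<in> I"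
      using T.ring_frac_eq_zero_iff[of "I +> s" "I +> r"] quot_map_eq_zero_iff[of r] sub
      by (simp add: eq image_subset_iff del: left_loc_simps)
    then show ?thesis using ring_frac_in_loc_ideal_iff x by simp
  qed
  moreover have "loc_ideal R S I \<subseteq> carrier (left_loc R S)"
    using Icarr by (auto simp: loc_ideal_def)
  ultimately have "a_kernel (left_loc R S) (left_loc (R Quot I) T) f = loc_ideal R S I"
    unfolding a_kernel_def' by blast
  then show ?thesis
    by (intro that[of f] ring_hom_ringI2[OF ring_left_loc T.ring_left_loc f]) (simp add: eq)+
qed

text \<open>Stability under right multiplication is not apparent from the fractions themselves; it
  holds because the set is the kernel of a ring homomorphism.\<close>

lemma ideal_loc_ideal: "ideal (loc_ideal R S I) (left_loc R S)"
proof -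
  let ?L' = "left_loc (R Quot I) (quot_map R I ` S)"
  obtain f where "ring_hom_ring (left_loc R S) ?L' f"
    "a_kernel (left_loc R S) ?L' f = loc_ideal R S I"
    by (rule left_loc_quot_map[OF quot_regular_left_Ore subset_refl])
  then show ?thesis using ring_hom_ring.kernel_is_ideal by metis
qed

lemma left_loc_quot_iso:
  "left_loc (R Quot I) (quot_map R I ` S) \<simeq> left_loc R S Quot loc_ideal R S I"
proof -
  let ?L' = "left_loc (R Quot I) (quot_map R I ` S)"
  obtain f where f: "ring_hom_ring (left_loc R S) ?L' f"
    "a_kernel (left_loc R S) ?L' f = loc_ideal R S I"
    "\<forall>s\<in>S. \<forall>r\<in>carrier R.
      f (ring_frac R S s r) = ring_frac (R Quot I) (quot_map R I ` S) (I +> s) (I +> r)"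
    by (rule left_loc_quot_map[OF quot_regular_left_Ore subset_refl])
  interpret f: ring_hom_ring "left_loc R S" ?L' f by (rule f(1))
  \<comment> \<open>Numerators and denominators both lift to \<open>R\<close>, the latter because
    the denominator set is exactly the image of \<open>S\<close>.\<close>
  have "carrier ?L' \<subseteq> f ` carrier (left_loc R S)"
  proof
    fix y assume "y \<in> carrier ?L'"
    then obtain U X where "U \<in> quot_map R I ` S" "X \<in> carrier (R Quot I)"
      "y = ring_frac (R Quot I) (quot_map R I ` S) U X"
      by (rule quot.left_locE)
    then obtain s r where "s \<in> S" "r \<in> carrier R"
      "y = ring_frac (R Quot I) (quot_map R I ` S) (I +> s) (I +> r)"
      by (auto simp: carrier_Quot)
    then have "y = f (ring_frac R S s r)" "ring_frac R S s r \<in> carrier (left_loc R S)"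
      by (simp_all add: f)
    then show "y \<in> f ` carrier (left_loc R S)" by blast
  qed
  then have "f ` carrier (left_loc R S) = carrier ?L'"
    by (intro equalityI image_subsetI f.hom_closed)
  then have "left_loc R S Quot loc_ideal R S I \<simeq> ?L'"
    using f.FactRing_iso unfolding f(2) by blast
  then show ?thesis
    by (rule ring_iso_sym[OF ideal.quotient_is_ring[OF ideal_loc_ideal]])
qed

lemma left_loc_quot_embedding:
  assumes T: "regular_left_Ore (R Quot I) T" and sub: "quot_map R I ` S \<subseteq> T"
  shows "\<exists>f\<in>ring_hom (left_loc R S Quot loc_ideal R S I) (left_loc (R Quot I) T).
    inj_on f (carrier (left_loc R S Quot loc_ideal R S I)) \<and>
    (\<forall>s\<in>S. \<forall>r\<in>carrier R. f (loc_ideal R S I +>\<^bsub>left_loc R S\<^esub> ring_frac R S s r)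
      = ring_frac (R Quot I) T (quot_map R I s) (quot_map R I r))"
proof -
  obtain f where f: "ring_hom_ring (left_loc R S) (left_loc (R Quot I) T) f"
    "a_kernel (left_loc R S) (left_loc (R Quot I) T) f = loc_ideal R S I"
    "\<forall>s\<in>S. \<forall>r\<in>carrier R. f (ring_frac R S s r) = ring_frac (R Quot I) T (I +> s) (I +> r)"
    by (rule left_loc_quot_map[OF T sub])
  interpret f: ring_hom_ring "left_loc R S" "left_loc (R Quot I) T" f by (rule f(1))
  \<comment> \<open>\<open>f\<close> is constant on the cosets of its kernel, so the image of a
    coset is a singleton, whose element is the induced value.\<close>
  let ?g = "\<lambda>X. the_elem (f ` X)"
  have "?g \<in> ring_hom (left_loc R S Quot loc_ideal R S I) (left_loc (R Quot I) T)"
    using f.the_elem_hom unfolding f(2) .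
  moreover have "inj_on ?g (carrier (left_loc R S Quot loc_ideal R S I))"
    using f.the_elem_inj unfolding f(2) by (rule inj_onI)
  moreover have "?g (loc_ideal R S I +>\<^bsub>left_loc R S\<^esub> ring_frac R S s r)
      = ring_frac (R Quot I) T (I +> s) (I +> r)" if "s \<in> S" "r \<in> carrier R" for s r
    using f.the_elem_simp[OF ring_frac_closed[OF that]] f(3) that unfolding f(2) by simp
  ultimately show ?thesis by blast
qed

lemma torsionfree_quot_module: "torsionfree_module R S (quot_module R I)"
proof (rule torsionfree_restrict_scalars[OF pi.S.ring_axioms pi.homh])
  fix s X
  assume "s \<in> S" and X: "X \<in> carrier (R Quot I)" "(I +> s) \<otimes>\<^bsub>R Quot I\<^esub> X = \<zero>\<^bsub>R Quot I\<^esub>"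
  have "I +> s \<in> quot_map R I ` S" using \<open>s \<in> S\<close> by (rule imageI)
  then show "X = \<zero>\<^bsub>R Quot I\<^esub>" using X by (rule quot.S_left_regular)
qed

text \<open>The map s^-1 r to s^-1 (r + I) is linear over the localized ring and onto, with kernel
  \<open>loc_ideal R S I\<close>; \<open>quot_module_iso\<close> then applies over
  \<open>left_loc R S\<close>.\<close>

lemma quot_left_loc_module_iso:
  "left_module_iso (left_loc R S) (quot_module (left_loc R S) (loc_ideal R S I))
    (left_loc_module R S (quot_module R I)) \<noteq> {}"
proof -
  let ?M = "quot_module R I" and ?L = "left_loc R S"
  interpret M: torsionfree_module R S ?M by (rule torsionfree_quot_module)
  interpret L: ideal "loc_ideal R S I" ?L by (rule ideal_loc_ideal)
  note [simp del] = left_loc_simps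
  have wd: "M.frac s (I +> r) = M.frac t (I +> q)"
    if 1: "s \<in> S" "r \<in> carrier R" "t \<in> S" "q \<in> carrier R"
      and eq: "ring_frac R S s r = ring_frac R S t q" for s r t q
  proof -
    have "u \<otimes> r = v \<otimes> q" if "u \<in> carrier R" "v \<in> carrier R" "u \<otimes> s = v \<otimes> t" for u v
      using that eq 1 by (simp add: reg.frac_eq_iff)
    then show ?thesis
      using 1 by (simp add: M.frac_eq_iff pi.hom_mult[symmetric] del: pi.hom_mult)
  qed
  have "\<exists>g. \<forall>x\<in>S \<times> carrier R. g (case x of (s, r) \<Rightarrow> ring_frac R S s r) =
      (case x of (s, r) \<Rightarrow> M.frac s (I +> r))"
    by (rule factor_through) (clarsimp, rule wd, assumption+)
  then obtain g where G: "\<forall>x\<in>S \<times> carrier R. g (case x of (s, r) \<Rightarrow> ring_frac R S s r) =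
      (case x of (s, r) \<Rightarrow> M.frac s (I +> r))" ..
  have g: "g (ring_frac R S s r) = M.frac s (I +> r)" if "s \<in> S" "r \<in> carrier R" for s r
    using G[rule_format, of "(s, r)"] that by simp
  show ?thesis
  proof (rule L.quot_module_iso)
    show "g ` carrier ?L = carrier (left_loc_module R S ?M)"
    proof
      show "g ` carrier ?L \<subseteq> carrier (left_loc_module R S ?M)"
      proof clarify
        fix x assume "x \<in> carrier ?L"
        then obtain s r where x: "s \<in> S" "r \<in> carrier R" "x = ring_frac R S s r" by (rule left_locE)
        then have "g x = M.frac s (I +> r)" "I +> r \<in> carrier ?M" by (simp_all add: g)
        then show "g x \<in> carrier (left_loc_module R S ?M)"
          using x(1) unfolding left_loc_module_def by auto
      qed
      show "carrier (left_loc_module R S ?M) \<subseteq> g ` carrier ?L"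
      proof
        fix X assume "X \<in> carrier (left_loc_module R S ?M)"
        then obtain s r where "s \<in> S" "r \<in> carrier R" "X = M.frac s (I +> r)"
          by (auto simp: left_loc_module_def carrier_Quot)
        then have "X = g (ring_frac R S s r)" "ring_frac R S s r \<in> carrier ?L"
          by (simp_all add: g)
        then show "X \<in> g ` carrier ?L" by blast
      qed
    qed
    fix x y assume x: "x \<in> carrier ?L" and y: "y \<in> carrier ?L"
    obtain s a b where xy: "s \<in> S" "a \<in> carrier R" "b \<in> carrier R"
      "x = ring_frac R S s a" "y = ring_frac R S s b"
      using x y by (rule left_loc_common2)
    then show "g (x \<oplus>\<^bsub>?L\<^esub> y) = g x \<oplus>\<^bsub>left_loc_module R S ?M\<^esub> g y"
      using M.frac_add_same[of s "I +> a" "I +> b"]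
      by (simp add: ring_frac_add g left_loc_module_def)
    \<comment> \<open>The difference is recovered from addition over the common denominator,
      reducing the kernel condition to \<open>a \<ominus> b \<in> I\<close>.\<close>
    have "x = ring_frac R S s (a \<ominus> b) \<oplus>\<^bsub>?L\<^esub> y"
      using xy by (simp add: ring_frac_add a_minus_def a_assoc l_neg)
    then have "x \<ominus>\<^bsub>?L\<^esub> y = ring_frac R S s (a \<ominus> b)"
      using y xy(1-3) by (simp add: L.minus_eq L.a_assoc L.r_neg)
    moreover have "g x = g y \<longleftrightarrow> a \<ominus> b \<in> I"
      using xy M.frac_eq_same[of s "I +> a" "I +> b"] by (simp add: g quot_map_eq_iff)
    ultimately show "g x = g y \<longleftrightarrow> x \<ominus>\<^bsub>?L\<^esub> y \<in> loc_ideal R S I"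
      using xy ring_frac_in_loc_ideal_iff by simp
  next
    fix x y assume x: "x \<in> carrier ?L" and y: "y \<in> carrier ?L"
    obtain t b where y': "t \<in> S" "b \<in> carrier R" "y = ring_frac R S t b"
      using y by (rule left_locE)
    obtain s a where x': "s \<in> S" "a \<in> carrier R" "x = ring_frac R S s (a \<otimes> t)"
      using x y'(1) by (rule left_loc_mult_form)
    show "g (x \<otimes>\<^bsub>?L\<^esub> y) = x \<odot>\<^bsub>left_loc_module R S ?M\<^esub> g y"
      using x' y' M.frac_smult_cancel[of s a t "I +> b"]
      by (simp add: ring_frac_mult g left_loc_module_def)
  qed
qed

end

section \<open>Primes and semiprimeness\<close>

context ring
begin

text \<open>The middle factor \<open>r\<close> absorbs multiplication on the side facing
  \<open>Z\<close>, and \<open>P\<close> absorbs it on the other side. Hence both sets are two-sided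
  ideals for an arbitrary subset \<open>Z\<close>.\<close>

lemma residual_ideal:
  assumes "ideal P R" and Z: "Z \<subseteq> carrier R"
  shows right_residual_ideal: "ideal {x \<in> carrier R. \<forall>z\<in>Z. \<forall>r\<in>carrier R. z \<otimes> r \<otimes> x \<in> P} R"
    (is "ideal ?A R")
    and left_residual_ideal: "ideal {x \<in> carrier R. \<forall>z\<in>Z. \<forall>r\<in>carrier R. x \<otimes> r \<otimes> z \<in> P} R"
    (is "ideal ?B R")
proof -
  interpret P: ideal P R by fact
  have Z': "z \<in> carrier R" if "z \<in> Z" for z using Z that by blast
  show "ideal ?A R"
  proof (rule idealI[OF ring_axioms])
    show "subgroup ?A (add_monoid R)"
    proof (rule add.subgroupI)
      have "\<zero> \<in> ?A" by (simp add: Z')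
      then show "?A \<noteq> {}" by blast
    qed (auto simp: a_inv_def[symmetric] Z' r_distr r_minus)
    fix a x assume a: "a \<in> ?A" and x: "x \<in> carrier R"
    have "z \<otimes> r \<otimes> (x \<otimes> a) = z \<otimes> (r \<otimes> x) \<otimes> a" "z \<otimes> r \<otimes> (a \<otimes> x) = z \<otimes> r \<otimes> a \<otimes> x"
      if "z \<in> Z" "r \<in> carrier R" for z r
      using that a x by (simp_all add: Z' m_assoc)
    then show "x \<otimes> a \<in> ?A" "a \<otimes> x \<in> ?A"
      using a x by (simp_all add: P.I_r_closed)
  qed
  show "ideal ?B R"
  proof (rule idealI[OF ring_axioms])
    show "subgroup ?B (add_monoid R)"
    proof (rule add.subgroupI)
      have "\<zero> \<in> ?B" by (simp add: Z')
      then show "?B \<noteq> {}" by blast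
    qed (auto simp: a_inv_def[symmetric] Z' l_distr l_minus)
    fix a x assume a: "a \<in> ?B" and x: "x \<in> carrier R"
    have "a \<otimes> x \<otimes> r \<otimes> z = a \<otimes> (x \<otimes> r) \<otimes> z" "x \<otimes> a \<otimes> r \<otimes> z = x \<otimes> (a \<otimes> r \<otimes> z)"
      if "z \<in> Z" "r \<in> carrier R" for z r
      using that a x by (simp_all add: Z' m_assoc)
    then show "x \<otimes> a \<in> ?B" "a \<otimes> x \<in> ?B"
      using a x by (simp_all add: P.I_l_closed)
  qed
qed

text \<open>\<open>J\<close> is the right residual of \<open>x\<close> and \<open>I\<close> the left
  residual of \<open>J\<close>. Unlike the ideals generated by \<open>x\<close> and
  \<open>y\<close>, these contain \<open>P\<close> automatically and require no description of
  generated elements.\<close>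

lemma ideals_of_annihilating_elements:
  assumes "ideal P R" "x \<in> carrier R" "y \<in> carrier R" "\<forall>r\<in>carrier R. x \<otimes> r \<otimes> y \<in> P"
  obtains I J where "ideal I R" "ideal J R" "P \<subseteq> I" "P \<subseteq> J" "x \<in> I" "y \<in> J"
    "\<forall>a\<in>I. \<forall>b\<in>J. a \<otimes> b \<in> P"
proof -
  interpret P: ideal P R by fact
  define J where "J = {b \<in> carrier R. \<forall>z\<in>{x}. \<forall>r\<in>carrier R. z \<otimes> r \<otimes> b \<in> P}"
  define I where "I = {a \<in> carrier R. \<forall>z\<in>J. \<forall>r\<in>carrier R. a \<otimes> r \<otimes> z \<in> P}"
  have JR: "J \<subseteq> carrier R" by (auto simp: J_def)
  show ?thesis
  proof (rule that)
    show "ideal I R" unfolding I_def by (rule left_residual_ideal[OF assms(1) JR])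
    show "ideal J R" unfolding J_def by (rule right_residual_ideal[OF assms(1)]) (simp add: assms)
    show "P \<subseteq> J" using assms(2) by (auto simp: J_def P.I_l_closed P.Icarr)
    show "P \<subseteq> I" using JR by (auto simp: I_def P.I_r_closed P.Icarr)
    show "x \<in> I" using assms(2) by (auto simp: I_def J_def)
    show "y \<in> J" using assms by (auto simp: J_def)
    show "\<forall>a\<in>I. \<forall>b\<in>J. a \<otimes> b \<in> P"
    proof (intro ballI)
      fix a b assume "a \<in> I" "b \<in> J"
      then have "\<forall>z\<in>J. \<forall>r\<in>carrier R. a \<otimes> r \<otimes> z \<in> P" "a \<in> carrier R" by (auto simp: I_def)
      then have "a \<otimes> \<one> \<otimes> b \<in> P" using \<open>b \<in> J\<close> one_closed by blast
      then show "a \<otimes> b \<in> P" using \<open>a \<in> carrier R\<close> by simp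
    qed
  qed
qed

lemma ideal_prod_subset:
  assumes "ideal P R" "\<forall>a\<in>I. \<forall>b\<in>J. a \<otimes> b \<in> P"
  shows "I \<cdot> J \<subseteq> P"
proof
  interpret P: ideal P R by fact
  fix s assume "s \<in> I \<cdot> J"
  then show "s \<in> P" by induction (use assms in auto)
qed

text \<open>Forwards, \<open>x\<close> and \<open>y\<close> are replaced by the ideals constructed
  above; backwards, an \<open>x\<close> in \<open>I\<close> outside \<open>P\<close> is multiplied
  with every \<open>y\<close> in \<open>J\<close>. The elementwise form is the one that can be
  checked on fractions.\<close>

theorem nc_prime_ideal_iff:
  "nc_prime_ideal R P \<longleftrightarrow> ideal P R \<and> P \<noteq> carrier R \<and>
    (\<forall>x\<in>carrier R. \<forall>y\<in>carrier R. (\<forall>r\<in>carrier R. x \<otimes> r \<otimes> y \<in> P) \<longrightarrow> x \<in> P \<or> y \<in> P)"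
  (is "?L \<longleftrightarrow> ?R")
proof
  assume L: ?L
  then have P: "ideal P R" by (simp add: nc_prime_ideal_def)
  have "x \<in> P \<or> y \<in> P"
    if xy: "x \<in> carrier R" "y \<in> carrier R" "\<forall>r\<in>carrier R. x \<otimes> r \<otimes> y \<in> P" for x y
  proof -
    obtain I J where IJ: "ideal I R" "ideal J R" "x \<in> I" "y \<in> J" "\<forall>a\<in>I. \<forall>b\<in>J. a \<otimes> b \<in> P"
      by (rule ideals_of_annihilating_elements[OF P xy])
    then have "I \<cdot> J \<subseteq> P" using ideal_prod_subset P by blast
    then have "I \<subseteq> P \<or> J \<subseteq> P" using L IJ unfolding nc_prime_ideal_def by blast
    then show ?thesis using IJ by blast
  qed
  then show ?R using L by (auto simp: nc_prime_ideal_def)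
next
  assume R: ?R
  have "J \<subseteq> P" if IJ: "ideal I R" "ideal J R" "I \<cdot> J \<subseteq> P" and nI: "\<not> I \<subseteq> P" for I J
  proof
    interpret I: ideal I R by fact
    interpret J: ideal J R by fact
    obtain x where x: "x \<in> I" "x \<notin> P" using nI by blast
    fix y assume y: "y \<in> J"
    have "x \<otimes> r \<otimes> y \<in> P" if "r \<in> carrier R" for r
    proof -
      have "x \<otimes> r \<otimes> y \<in> I \<cdot> J" using that x y by (intro ideal_prod.prod I.I_r_closed)
      then show ?thesis using IJ(3) by blast
    qed
    then show "y \<in> P" using R x y I.Icarr J.Icarr by blast
  qed
  then show ?L using R unfolding nc_prime_ideal_def by blast
qed

lemma prime_idealD:
  assumes "nc_prime_ideal R P" "x \<in> carrier R" "y \<in> carrier R"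
    and "\<And>r. r \<in> carrier R \<Longrightarrow> x \<otimes> r \<otimes> y \<in> P"
  shows "x \<in> P \<or> y \<in> P"
  using assms unfolding nc_prime_ideal_iff by blast

text \<open>An m-sequence \<open>a, a r a, \<dots>\<close> of nonzero elements starts at every nonzero \<open>a\<close>; an ideal
  that is maximal among those avoiding it is prime.\<close>

lemma prime_ideal_avoiding:
  assumes nil: "\<And>b. \<lbrakk> b \<in> carrier R; \<forall>r\<in>carrier R. b \<otimes> r \<otimes> b = \<zero> \<rbrakk> \<Longrightarrow> b = \<zero>"
    and a: "a \<in> carrier R" "a \<noteq> \<zero>"
  shows "\<exists>P. nc_prime_ideal R P \<and> a \<notin> P"
proof -
  have "\<forall>b\<in>carrier R - {\<zero>}. \<exists>r. r \<in> carrier R \<and> b \<otimes> r \<otimes> b \<noteq> \<zero>"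
    using nil by blast
  then obtain c where c: "\<And>b. \<lbrakk> b \<in> carrier R; b \<noteq> \<zero> \<rbrakk> \<Longrightarrow> c b \<in> carrier R \<and> b \<otimes> c b \<otimes> b \<noteq> \<zero>"
    using bchoice[of "carrier R - {\<zero>}" "\<lambda>b r. r \<in> carrier R \<and> b \<otimes> r \<otimes> b \<noteq> \<zero>"] by blast
  define A where "A = rec_nat a (\<lambda>_ b. b \<otimes> c b \<otimes> b)"
  have A0: "A 0 = a" and AS: "A (Suc n) = A n \<otimes> c (A n) \<otimes> A n" for n
    by (simp_all add: A_def)
  have A: "A n \<in> carrier R \<and> A n \<noteq> \<zero>" for n
    by (induction n) (use a c in \<open>simp_all add: A0 AS\<close>)
  \<comment> \<open>Each term is a left multiple of its predecessor, so an ideal that contains one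
    term contains all later ones.\<close>
  have up: "A m \<in> I" if "ideal I R" "A n \<in> I" "n \<le> m" for I n m
    using that(3)
  proof (induction rule: dec_induct)
    case (step k)
    then show ?case
      using A[of k] c[of "A k"] by (simp add: AS ideal.I_l_closed[OF that(1)])
  qed (rule that(2))
  define \<A> where "\<A> = {I. ideal I R \<and> I \<inter> range A = {}}"
  have "\<exists>P\<in>\<A>. \<forall>I\<in>\<A>. P \<subseteq> I \<longrightarrow> I = P"
  proof (rule subset_Zorn_nonempty)
    have "\<zero> \<notin> range A" using A by (metis rangeE)
    then have "{\<zero>} \<in> \<A>" using zeroideal by (simp add: \<A>_def)
    then show "\<A> \<noteq> {}" by blast
  next
    fix \<C> assume C: "\<C> \<noteq> {}" "subset.chain \<A> \<C>"
    then have "subset.chain {I. ideal I R} \<C>"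
      unfolding subset_chain_def \<A>_def by blast
    then have "ideal (\<Union>\<C>) R" using chain_Union_is_ideal[of \<C>] C(1) by simp
    then show "\<Union>\<C> \<in> \<A>" using C(2) unfolding subset_chain_def \<A>_def by blast
  qed
  then obtain P where P: "P \<in> \<A>" and max: "\<And>I. \<lbrakk> I \<in> \<A>; P \<subseteq> I \<rbrakk> \<Longrightarrow> I = P" by blast
  then have PI: "ideal P R" and PA: "A n \<notin> P" for n by (auto simp: \<A>_def)
  have hits: "\<exists>n. A n \<in> I" if "ideal I R" "P \<subseteq> I" "I \<noteq> P" for I
    using max[of I] that unfolding \<A>_def by blast
  have "x \<in> P \<or> y \<in> P"
    if xy: "x \<in> carrier R" "y \<in> carrier R" "\<forall>r\<in>carrier R. x \<otimes> r \<otimes> y \<in> P" for x y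
  proof (rule ccontr)
    assume neg: "\<not> (x \<in> P \<or> y \<in> P)"
    obtain I J where IJ: "ideal I R" "ideal J R" "P \<subseteq> I" "P \<subseteq> J" "x \<in> I" "y \<in> J"
      and prod: "\<forall>a\<in>I. \<forall>b\<in>J. a \<otimes> b \<in> P"
      by (rule ideals_of_annihilating_elements[OF PI xy])
    \<comment> \<open>Both ideals strictly contain \<open>P\<close> and so meet the sequence by
      maximality. From the larger index on they share a term, and the next term, a product of an
      element of \<open>I\<close> with one of \<open>J\<close>, falls into \<open>P\<close>.\<close>
    obtain m n where "A m \<in> I" "A n \<in> J" using hits[of I] hits[of J] IJ neg by metis
    then have k: "A (max m n) \<in> I" "A (max m n) \<in> J"
      using up[OF IJ(1), of m "max m n"] up[OF IJ(2), of n "max m n"] by simp_all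
    have "A (max m n) \<otimes> c (A (max m n)) \<in> I"
      using k(1) c A by (intro ideal.I_r_closed[OF IJ(1)]) auto
    then have "A (Suc (max m n)) \<in> P" using prod k(2) by (simp add: AS)
    with PA show False by blast
  qed
  moreover have "P \<noteq> carrier R" using PA[of 0] a by (auto simp: A0)
  ultimately have "nc_prime_ideal R P" using PI by (simp add: nc_prime_ideal_iff)
  with PA[of 0] show ?thesis by (auto simp: A0)
qed

text \<open>If a R a = 0, then \<open>a\<close> lies in every prime by the elementwise criterion;
  conversely, \<open>prime_ideal_avoiding\<close> supplies a prime missing any given nonzero
  element.\<close>

theorem semiprime_ring_iff:
  assumes "\<one> \<noteq> \<zero>"
  shows "semiprime_ring R \<longleftrightarrow>
    (\<forall>a\<in>carrier R. (\<forall>r\<in>carrier R. a \<otimes> r \<otimes> a = \<zero>) \<longrightarrow> a = \<zero>)"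
  (is "?L \<longleftrightarrow> ?R")
proof
  assume ?L
  then interpret semiprime_ring R .
  show ?R
  proof (intro ballI impI)
    fix a assume a: "a \<in> carrier R" "\<forall>r\<in>carrier R. a \<otimes> r \<otimes> a = \<zero>"
    have "a \<in> P" if "nc_prime_ideal R P" for P
    proof -
      interpret P: ideal P R using that by (simp add: nc_prime_ideal_def)
      show ?thesis using prime_idealD[OF that a(1) a(1)] a(2) by simp
    qed
    then show "a = \<zero>" using Inter_primes a(1) by blast
  qed
next
  assume R: ?R
  have "\<zero> \<in> P" if "nc_prime_ideal R P" for P
    using that by (simp add: nc_prime_ideal_def additive_subgroup.zero_closed ideal.axioms(1))
  moreover have "\<exists>P. nc_prime_ideal R P \<and> a \<notin> P" if "a \<in> carrier R" "a \<noteq> \<zero>" for a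
    using R that by (intro prime_ideal_avoiding) simp_all
  ultimately have "{r \<in> carrier R. \<forall>P. nc_prime_ideal R P \<longrightarrow> r \<in> P} = {\<zero>}"
    by blast
  then show ?L using assms ring_axioms by (simp add: semiprime_ring_def semiprime_ring_axioms_def)
qed

text \<open>The intersection of a nonempty chain of primes is prime. Zorn's lemma is applied to the
  complements of the primes inside \<open>P\<close>, so that a maximal complement belongs to a
  minimal prime.\<close>

lemma prime_ideal_contains_min_prime:
  assumes P: "nc_prime_ideal R P"
  shows "\<exists>M\<in>min_primes R. M \<subseteq> P"
proof -
  have sub: "Q \<subseteq> carrier R" if "nc_prime_ideal R Q" for Q
    using that by (auto simp: nc_prime_ideal_def dest: ideal.Icarr)
  define \<Q> where "\<Q> = {Q. nc_prime_ideal R Q \<and> Q \<subseteq> P}"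
  define \<A> where "\<A> = (-) (carrier R) ` \<Q>"
  have "\<exists>M\<in>\<A>. \<forall>X\<in>\<A>. M \<subseteq> X \<longrightarrow> X = M"
  proof (rule subset_Zorn_nonempty)
    show "\<A> \<noteq> {}" using P by (auto simp: \<A>_def \<Q>_def)
  next
    fix \<C> assume C: "\<C> \<noteq> {}" "subset.chain \<A> \<C>"
    have CA: "X \<in> \<A>" if "X \<in> \<C>" for X
      using C(2) that by (auto simp: subset_chain_def)
    have C_chain: "X \<subseteq> Y \<or> Y \<subseteq> X" if "X \<in> \<C>" "Y \<in> \<C>" for X Y
      using C(2) that by (auto simp: subset_chain_def)
    define \<D> where "\<D> = (-) (carrier R) ` \<C>"
    have D: "nc_prime_ideal R Q" "Q \<subseteq> P" if Q: "Q \<in> \<D>" for Q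
    proof -
      obtain X where X: "X \<in> \<C>" "Q = carrier R - X" using Q by (auto simp: \<D>_def)
      obtain Q' where "nc_prime_ideal R Q'" "Q' \<subseteq> P" "X = carrier R - Q'"
        using CA[OF X(1)] by (auto simp: \<A>_def \<Q>_def)
      then show "nc_prime_ideal R Q" "Q \<subseteq> P"
        using sub[of Q'] X(2) by (simp_all add: double_diff)
    qed
    have chain: "Q \<subseteq> Q' \<or> Q' \<subseteq> Q" if QQ': "Q \<in> \<D>" "Q' \<in> \<D>" for Q Q'
    proof -
      obtain X Y where "X \<in> \<C>" "Y \<in> \<C>" "Q = carrier R - X" "Q' = carrier R - Y"
        using QQ' by (auto simp: \<D>_def)
      then show ?thesis using C_chain[of X Y] by blast
    qed
    obtain Q0 where Q0: "Q0 \<in> \<D>" using C(1) by (auto simp: \<D>_def)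
    have "nc_prime_ideal R (\<Inter>\<D>)"
      unfolding nc_prime_ideal_iff
    proof (intro conjI ballI impI)
      show "ideal (\<Inter>\<D>) R"
        using D(1) Q0 by (intro i_Intersect) (auto simp: nc_prime_ideal_def)
      have "Q0 \<noteq> carrier R" "Q0 \<subseteq> carrier R"
        using D(1)[OF Q0] sub by (simp_all add: nc_prime_ideal_def)
      then show "\<Inter>\<D> \<noteq> carrier R" using Q0 by blast
      fix x y assume xy: "x \<in> carrier R" "y \<in> carrier R" "\<forall>r\<in>carrier R. x \<otimes> r \<otimes> y \<in> \<Inter>\<D>"
      show "x \<in> \<Inter>\<D> \<or> y \<in> \<Inter>\<D>"
      proof (rule ccontr)
        assume "\<not> (x \<in> \<Inter>\<D> \<or> y \<in> \<Inter>\<D>)"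
        then obtain Q1 Q2 where Q12: "Q1 \<in> \<D>" "x \<notin> Q1" "Q2 \<in> \<D>" "y \<notin> Q2" by blast
        \<comment> \<open>The smaller of \<open>Q1\<close> and \<open>Q2\<close> misses both
          \<open>x\<close> and \<open>y\<close>.\<close>
        then obtain Q where Q: "Q \<in> \<D>" "x \<notin> Q" "y \<notin> Q" using chain[OF Q12(1,3)] by blast
        have "x \<otimes> r \<otimes> y \<in> Q" if "r \<in> carrier R" for r using xy(3) Q(1) that by blast
        then show False using prime_idealD[OF D(1)[OF Q(1)] xy(1,2)] Q(2,3) by blast
      qed
    qed
    moreover have "\<Inter>\<D> \<subseteq> P" using D(2)[OF Q0] Q0 by blast
    moreover have "\<Union>\<C> = carrier R - \<Inter>\<D>"
    proof -
      have "X \<subseteq> carrier R" if "X \<in> \<C>" for X using CA[OF that] by (auto simp: \<A>_def)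
      then show ?thesis by (auto simp: \<D>_def)
    qed
    ultimately show "\<Union>\<C> \<in> \<A>" by (auto simp: \<A>_def \<Q>_def)
  qed
  then obtain X where X: "X \<in> \<A>" and X_max: "\<forall>Y\<in>\<A>. X \<subseteq> Y \<longrightarrow> Y = X" ..
  obtain M where M: "nc_prime_ideal R M" "M \<subseteq> P" "X = carrier R - M"
    using X by (auto simp: \<A>_def \<Q>_def)
  have "Q = M" if Q: "nc_prime_ideal R Q" "Q \<subseteq> M" for Q
  proof -
    have "carrier R - Q \<in> \<A>" using Q M(2) by (auto simp: \<A>_def \<Q>_def)
    moreover have "X \<subseteq> carrier R - Q" using Q(2) M(3) by blast
    ultimately have "carrier R - Q = carrier R - M" using X_max M(3) by simp
    then show ?thesis using sub[OF Q(1)] sub[OF M(1)] by blast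
  qed
  then have "M \<in> min_primes R" using M by (simp add: min_primes_def)
  with M show ?thesis by blast
qed

text \<open>By induction: for \<open>e\<close> and for \<open>q\<close> in \<open>Q\<close>, both
  outside \<open>P\<close>, primeness gives an \<open>r\<close> with
  \<open>e \<otimes> r \<otimes> q\<close> outside \<open>P\<close>, and this product lies in
  \<open>Q\<close> and in every ideal containing \<open>e\<close>.\<close>

lemma finite_Inter_subset_prime:
  assumes P: "nc_prime_ideal R P" and "finite F" and F: "\<And>Q. Q \<in> F \<Longrightarrow> ideal Q R"
    and "\<And>Q. Q \<in> F \<Longrightarrow> \<not> Q \<subseteq> P"
  shows "\<exists>e\<in>carrier R. e \<notin> P \<and> (\<forall>Q\<in>F. e \<in> Q)"
proof -
  interpret P: ideal P R using P by (simp add: nc_prime_ideal_def)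
  show ?thesis
    using assms(2-4)
  proof (induction F rule: finite_induct)
    case empty
    have "\<one> \<notin> P" using P P.one_imp_carrier by (auto simp: nc_prime_ideal_def)
    then show ?case by auto
  next
    case (insert Q F)
    interpret Q: ideal Q R using insert.prems by simp
    obtain e where e: "e \<in> carrier R" "e \<notin> P" "\<forall>Q\<in>F. e \<in> Q"
      using insert.IH insert.prems by blast
    obtain q where q: "q \<in> Q" "q \<notin> P" using insert.prems by blast
    obtain r where r: "r \<in> carrier R" "e \<otimes> r \<otimes> q \<notin> P"
      using prime_idealD[OF P e(1) Q.Icarr[OF q(1)]] e q by blast
    have "e \<otimes> r \<otimes> q \<in> Q'" if "Q' \<in> F" for Q'
      using that e insert.prems(1)[of Q'] r(1) Q.Icarr[OF q(1)]
      by (simp add: ideal.I_r_closed)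
    moreover have "e \<otimes> r \<otimes> q \<in> Q" using e r q Q.I_l_closed by simp
    ultimately show ?case using r e Q.Icarr[OF q(1)] by (intro bexI[of _ "e \<otimes> r \<otimes> q"]) auto
  qed
qed

end

section \<open>Regular elements modulo minimal primes\<close>

lemma (in semiprime_ring) Inter_min_primes:
  assumes "r \<in> carrier R" "\<And>P. P \<in> min_primes R \<Longrightarrow> r \<in> P"
  shows "r = \<zero>"
proof -
  have "r \<in> P" if "nc_prime_ideal R P" for P
    using prime_ideal_contains_min_prime[OF that] assms(2) by blast
  then show ?thesis using Inter_primes assms(1) by blast
qed

text \<open>An element \<open>e\<close> outside \<open>P\<close> lying in all other minimal primes makes \<open>P\<close> the left and right
  annihilator of the ideal generated by \<open>e\<close>, so that regular elements cancel modulo \<open>P\<close>.\<close>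

lemma (in semiprime_ring) regular_saturates_min_prime:
  assumes fin: "finite (min_primes R)" and P: "P \<in> min_primes R"
    and s: "s \<in> regular_elements R" and r: "r \<in> carrier R"
  shows "s \<otimes> r \<in> P \<Longrightarrow> r \<in> P" and "r \<otimes> s \<in> P \<Longrightarrow> r \<in> P"
proof -
  have prime: "nc_prime_ideal R Q" if "Q \<in> min_primes R" for Q
    using that by (simp add: min_primes_def)
  have ideal: "ideal Q R" if "Q \<in> min_primes R" for Q
    using prime[OF that] by (simp add: nc_prime_ideal_def)
  have incomparable: "\<not> Q \<subseteq> P" if "Q \<in> min_primes R - {P}" for Q
  proof
    assume "Q \<subseteq> P"
    moreover have "nc_prime_ideal R Q" using prime that by blast
    ultimately have "Q = P" using P by (simp add: min_primes_def)
    then show False using that by simp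
  qed
  have "\<exists>e\<in>carrier R. e \<notin> P \<and> (\<forall>Q\<in>min_primes R - {P}. e \<in> Q)"
  proof (rule finite_Inter_subset_prime[OF prime[OF P]])
    show "finite (min_primes R - {P})" using fin by simp
  qed (blast intro: ideal, rule incomparable)
  then obtain e where e: "e \<in> carrier R" "e \<notin> P" "\<forall>Q\<in>min_primes R - {P}. e \<in> Q" by blast
  have sc: "s \<in> carrier R" using s by (simp add: regular_elements_def)
  have s_cancel: "x = \<zero>" if "x \<in> carrier R" "s \<otimes> x = \<zero> \<or> x \<otimes> s = \<zero>" for x
    using s that unfolding regular_elements_def by blast
  have zero_l: "x \<otimes> q \<otimes> e = \<zero>" and zero_r: "e \<otimes> q \<otimes> x = \<zero>"
    if x: "x \<in> P" and q: "q \<in> carrier R" for x q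
  proof -
    have xc: "x \<in> carrier R" using ideal.Icarr[OF ideal[OF P] x] .
    \<comment> \<open>\<open>x\<close> takes care of the prime \<open>P\<close> and \<open>e\<close>
      of all other minimal primes, whose total intersection is zero.\<close>
    have "x \<otimes> q \<otimes> e \<in> Q \<and> e \<otimes> q \<otimes> x \<in> Q" if Q: "Q \<in> min_primes R" for Q
    proof -
      interpret Q: ideal Q R by (rule ideal[OF Q])
      have "x \<in> Q \<or> e \<in> Q" using x e(3) Q by blast
      then show ?thesis
      proof
        assume "x \<in> Q"
        then show ?thesis using q e(1) by (simp add: Q.I_l_closed Q.I_r_closed)
      next
        assume "e \<in> Q"
        then show ?thesis using q xc by (simp add: Q.I_l_closed Q.I_r_closed)
      qed
    qed
    then show "x \<otimes> q \<otimes> e = \<zero>" "e \<otimes> q \<otimes> x = \<zero>"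
      using xc q e(1) by (simp_all add: Inter_min_primes)
  qed
  interpret P: ideal P R by (rule ideal[OF P])
  show "r \<in> P" if "s \<otimes> r \<in> P"
  proof -
    \<comment> \<open>Regularity of \<open>s\<close> is used in \<open>R\<close>, where the product
      with \<open>s\<close> is actually zero; primeness of \<open>P\<close> then discards
      \<open>e\<close>.\<close>
    have "r \<otimes> q \<otimes> e \<in> P" if q: "q \<in> carrier R" for q
    proof -
      have "s \<otimes> (r \<otimes> q \<otimes> e) = s \<otimes> r \<otimes> q \<otimes> e"
        using sc r q e(1) by (simp add: m_assoc)
      also have "\<dots> = \<zero>" using zero_l[OF \<open>s \<otimes> r \<in> P\<close> q] .
      finally have "r \<otimes> q \<otimes> e = \<zero>" using s_cancel r q e(1) by simp
      then show ?thesis by simp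
    qed
    then have "r \<in> P \<or> e \<in> P" by (rule prime_idealD[OF prime[OF P] r e(1)])
    then show ?thesis using e(2) by simp
  qed
  show "r \<in> P" if "r \<otimes> s \<in> P"
  proof -
    have "e \<otimes> q \<otimes> r \<in> P" if q: "q \<in> carrier R" for q
    proof -
      have "(e \<otimes> q \<otimes> r) \<otimes> s = e \<otimes> q \<otimes> (r \<otimes> s)"
        using sc r q e(1) by (simp add: m_assoc)
      also have "\<dots> = \<zero>" using zero_r[OF \<open>r \<otimes> s \<in> P\<close> q] .
      finally have "e \<otimes> q \<otimes> r = \<zero>" using s_cancel r q e(1) by simp
      then show ?thesis by simp
    qed
    then have "e \<in> P \<or> r \<in> P" by (rule prime_idealD[OF prime[OF P] e(1) r])
    then show ?thesis using e(2) by simp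
  qed
qed

section \<open>Primes of the localization\<close>

lemma (in regular_left_Ore) semiprime_left_loc:
  assumes "semiprime_ring R"
  shows "semiprime_ring (left_loc R S)"
proof -
  let ?L = "left_loc R S"
  interpret L: ring ?L by (rule ring_left_loc)
  have nil: "a = \<zero>" if "a \<in> carrier R" "\<forall>r\<in>carrier R. a \<otimes> r \<otimes> a = \<zero>" for a
    using assms that unfolding semiprime_ring_iff[OF one_not_zero] by blast
  note [simp del] = left_loc_simps
  have nz: "\<one>\<^bsub>?L\<^esub> \<noteq> \<zero>\<^bsub>?L\<^esub>"
    using ring_frac_eq_zero_iff[of \<one> \<one>] one_not_zero by (simp add: left_loc_simps(1))
  show ?thesis
    unfolding L.semiprime_ring_iff[OF nz]
  proof (intro ballI impI)
    fix x assume "x \<in> carrier ?L" and x0: "\<forall>z\<in>carrier ?L. x \<otimes>\<^bsub>?L\<^esub> z \<otimes>\<^bsub>?L\<^esub> x = \<zero>\<^bsub>?L\<^esub>"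
    then obtain s a where x: "s \<in> S" "a \<in> carrier R" "x = ring_frac R S s a"
      by (elim left_locE)
    have "a \<otimes> r \<otimes> a = \<zero>" if r: "r \<in> carrier R" for r
    proof -
      \<comment> \<open>The trailing \<open>s\<close> of the middle factor cancels the denominator
        of the second \<open>x\<close>.\<close>
      have "x \<otimes>\<^bsub>?L\<^esub> ring_frac R S \<one> (r \<otimes> s) = ring_frac R S s ((a \<otimes> r) \<otimes> s)"
        using ring_frac_mult[of s a \<one> "r \<otimes> s"] x r by (simp add: m_assoc)
      then have "x \<otimes>\<^bsub>?L\<^esub> ring_frac R S \<one> (r \<otimes> s) \<otimes>\<^bsub>?L\<^esub> x = ring_frac R S s (a \<otimes> r \<otimes> a)"
        using x r by (simp add: ring_frac_mult)
      moreover have "x \<otimes>\<^bsub>?L\<^esub> ring_frac R S \<one> (r \<otimes> s) \<otimes>\<^bsub>?L\<^esub> x = \<zero>\<^bsub>?L\<^esub>"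
        using x0 x r by simp
      ultimately show ?thesis
        using ring_frac_eq_zero_iff[of s "a \<otimes> r \<otimes> a"] x r by simp
    qed
    then have "a = \<zero>" by (intro nil x(2)) simp
    then show "x = \<zero>\<^bsub>?L\<^esub>" using x ring_frac_eq_zero_iff[of s a] by simp
  qed
qed

lemma (in saturated_ideal) prime_loc_ideal:
  assumes "nc_prime_ideal R I"
  shows "nc_prime_ideal (left_loc R S) (loc_ideal R S I)"
proof -
  let ?L = "left_loc R S" and ?J = "loc_ideal R S I"
  interpret L: ring ?L by (rule ring_left_loc)
  note [simp del] = left_loc_simps
  show ?thesis
    unfolding L.nc_prime_ideal_iff
  proof (intro conjI ballI impI ideal_loc_ideal)
    have "\<one> \<notin> I" using one_imp_carrier proper by blast
    then have "ring_frac R S \<one> \<one> \<notin> ?J" using ring_frac_in_loc_ideal_iff by simp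
    then show "?J \<noteq> carrier ?L" using ring_frac_closed by blast
    fix x y
    assume "x \<in> carrier ?L" "y \<in> carrier ?L"
      and xy: "\<forall>z\<in>carrier ?L. x \<otimes>\<^bsub>?L\<^esub> z \<otimes>\<^bsub>?L\<^esub> y \<in> ?J"
    then obtain s a t b where x: "s \<in> S" "a \<in> carrier R" "x = ring_frac R S s a"
      and y: "t \<in> S" "b \<in> carrier R" "y = ring_frac R S t b"
      by (elim left_locE)
    have "a \<otimes> r \<otimes> b \<in> I" if r: "r \<in> carrier R" for r
    proof -
      \<comment> \<open>Here the middle factor ends in \<open>t\<close> to cancel the denominator of
        \<open>y\<close>.\<close>
      have "x \<otimes>\<^bsub>?L\<^esub> ring_frac R S \<one> (r \<otimes> t) = ring_frac R S s ((a \<otimes> r) \<otimes> t)"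
        using ring_frac_mult[of s a \<one> "r \<otimes> t"] x y r by (simp add: m_assoc)
      then have "x \<otimes>\<^bsub>?L\<^esub> ring_frac R S \<one> (r \<otimes> t) \<otimes>\<^bsub>?L\<^esub> y = ring_frac R S s (a \<otimes> r \<otimes> b)"
        using x y r by (simp add: ring_frac_mult)
      moreover have "x \<otimes>\<^bsub>?L\<^esub> ring_frac R S \<one> (r \<otimes> t) \<otimes>\<^bsub>?L\<^esub> y \<in> ?J"
        using xy y r by simp
      ultimately show ?thesis
        using ring_frac_in_loc_ideal_iff[of s "a \<otimes> r \<otimes> b"] x y r by simp
    qed
    then have "a \<in> I \<or> b \<in> I" by (rule prime_idealD[OF assms x(2) y(2)])
    then show "x \<in> ?J \<or> y \<in> ?J"
      using ring_frac_in_loc_ideal_iff x y by simp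
  qed
qed

text \<open>Fractions with denominator one recover the ideal from its localization. Incomparable
  minimal primes therefore stay incomparable in the localized ring.\<close>

lemma (in saturated_ideal) loc_ideal_subset_iff:
  assumes "saturated_ideal R S J"
  shows "loc_ideal R S I \<subseteq> loc_ideal R S J \<longleftrightarrow> I \<subseteq> J"
proof
  interpret J: saturated_ideal R S J by fact
  assume sub: "loc_ideal R S I \<subseteq> loc_ideal R S J"
  show "I \<subseteq> J"
  proof
    fix r assume r: "r \<in> I"
    then have "ring_frac R S \<one> r \<in> loc_ideal R S J"
      using sub ring_frac_in_loc_ideal_iff[of \<one> r] Icarr by auto
    then show "r \<in> J" using J.ring_frac_in_loc_ideal_iff[of \<one> r] r Icarr by simp
  qed
qed (auto simp: loc_ideal_def)

locale semiprime_left_Ore = semiprime_ring R + regular_left_Ore R S for R (structure) and S +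
  assumes finite_min_primes: "finite (min_primes R)"
begin

lemma saturated_min_prime:
  assumes "\<pp> \<in> min_primes R"
  shows "saturated_ideal R S \<pp>"
proof -
  have "nc_prime_ideal R \<pp>" using assms by (simp add: min_primes_def)
  then have "ideal \<pp> R" "\<pp> \<noteq> carrier R" by (simp_all add: nc_prime_ideal_def)
  moreover have "r \<in> \<pp>" if "s \<in> S" "r \<in> carrier R" "s \<otimes> r \<in> \<pp> \<or> r \<otimes> s \<in> \<pp>" for s r
    using regular_saturates_min_prime[OF finite_min_primes assms _ that(2), of s] reg that(1,3)
    by blast
  ultimately show ?thesis
    by (intro saturated_ideal.intro saturated_ideal_axioms.intro regular_left_Ore_axioms) blast+
qed

theorem min_primes_left_loc:
  "min_primes (left_loc R S) = {loc_ideal R S \<pp> |\<pp>. \<pp> \<in> min_primes R}"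
proof -
  let ?L = "left_loc R S"
  interpret L: ring ?L by (rule ring_left_loc)
  note [simp del] = left_loc_simps
  have prime: "nc_prime_ideal ?L (loc_ideal R S \<pp>)" if "\<pp> \<in> min_primes R" for \<pp>
    using saturated_ideal.prime_loc_ideal[OF saturated_min_prime[OF that]] that
    by (simp add: min_primes_def)
  have contains: "\<exists>\<pp>\<in>min_primes R. loc_ideal R S \<pp> \<subseteq> P" if P: "nc_prime_ideal ?L P" for P
  proof (rule ccontr)
    assume neg: "\<not> (\<exists>\<pp>\<in>min_primes R. loc_ideal R S \<pp> \<subseteq> P)"
    \<comment> \<open>Otherwise some \<open>e\<close> outside \<open>P\<close> lies in every
      localized minimal prime. Its numerator then lies in every minimal prime of \<open>R\<close>,
      so \<open>e\<close> is zero and belongs to \<open>P\<close> after all.\<close>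
    have "\<exists>e\<in>carrier ?L. e \<notin> P \<and> (\<forall>Q\<in>loc_ideal R S ` min_primes R. e \<in> Q)"
    proof (rule L.finite_Inter_subset_prime[OF P])
      show "finite (loc_ideal R S ` min_primes R)" using finite_min_primes by simp
      show "ideal Q ?L" if "Q \<in> loc_ideal R S ` min_primes R" for Q
        using that prime by (auto simp: nc_prime_ideal_def)
      show "\<not> Q \<subseteq> P" if "Q \<in> loc_ideal R S ` min_primes R" for Q
        using that neg by blast
    qed
    then obtain e where e: "e \<in> carrier ?L" "e \<notin> P"
      and e_in: "\<And>\<pp>. \<pp> \<in> min_primes R \<Longrightarrow> e \<in> loc_ideal R S \<pp>" by blast
    obtain s r where sr: "s \<in> S" "r \<in> carrier R" "e = ring_frac R S s r"
      using e(1) by (rule left_locE)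
    have "r = \<zero>"
    proof (rule Inter_min_primes[OF sr(2)])
      fix \<pp> assume \<pp>: "\<pp> \<in> min_primes R"
      show "r \<in> \<pp>"
        using saturated_ideal.ring_frac_in_loc_ideal_iff[OF saturated_min_prime[OF \<pp>] sr(1,2)]
          e_in[OF \<pp>] sr(3) by simp
    qed
    then have "e = \<zero>\<^bsub>?L\<^esub>" using ring_frac_eq_zero_iff sr by simp
    moreover have "\<zero>\<^bsub>?L\<^esub> \<in> P"
      using P by (simp add: nc_prime_ideal_def additive_subgroup.zero_closed ideal.axioms(1))
    ultimately show False using e(2) by simp
  qed
  show ?thesis
  proof (intro equalityI subsetI)
    fix P assume "P \<in> min_primes ?L"
    then have P: "nc_prime_ideal ?L P" "\<And>P'. \<lbrakk> nc_prime_ideal ?L P'; P' \<subseteq> P \<rbrakk> \<Longrightarrow> P' = P"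
      by (simp_all add: min_primes_def)
    obtain \<pp> where "\<pp> \<in> min_primes R" "loc_ideal R S \<pp> \<subseteq> P" using contains[OF P(1)] ..
    then have "loc_ideal R S \<pp> = P" by (intro P(2) prime)
    then show "P \<in> {loc_ideal R S \<pp> |\<pp>. \<pp> \<in> min_primes R}" using \<open>\<pp> \<in> min_primes R\<close> by blast
  next
    fix P assume "P \<in> {loc_ideal R S \<pp> |\<pp>. \<pp> \<in> min_primes R}"
    then obtain \<pp> where \<pp>: "\<pp> \<in> min_primes R" "P = loc_ideal R S \<pp>" by blast
    have "P' = P" if P': "nc_prime_ideal ?L P'" "P' \<subseteq> P" for P'
    proof -
      obtain \<qq> where \<qq>: "\<qq> \<in> min_primes R" "loc_ideal R S \<qq> \<subseteq> P'" using contains[OF P'(1)] ..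
      then have "loc_ideal R S \<qq> \<subseteq> loc_ideal R S \<pp>" using P'(2) \<pp>(2) by simp
      then have "\<qq> \<subseteq> \<pp>"
        using saturated_ideal.loc_ideal_subset_iff[OF saturated_min_prime saturated_min_prime]
          \<qq>(1) \<pp>(1) by blast
      then have "\<qq> = \<pp>" using \<qq>(1) \<pp>(1) by (simp add: min_primes_def)
      then show ?thesis using \<qq>(2) P'(2) \<pp>(2) by blast
    qed
    then show "P \<in> min_primes ?L" using prime[OF \<pp>(1)] \<pp>(2) by (simp add: min_primes_def)
  qed
qed

end

section \<open>Application to the largest left quotient ring\<close>

lemma regular_left_Ore_S_l:
  assumes "ring R" "\<one>\<^bsub>R\<^esub> \<noteq> \<zero>\<^bsub>R\<^esub>"
  shows "regular_left_Ore R (S_l R)"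
  using S_l_largest[OF assms] assms(1)
  by (simp add: is_largest_regular_left_Ore_set_def regular_left_Ore_def regular_left_Ore_axioms_def)

theorem corollary3p3:
  fixes R :: "('a, 'b) ring_scheme"
  assumes "semiprime_ring R"
  shows "semiprime_ring (Q_l R) \<and>
    (finite (min_primes R) \<longrightarrow>
      min_primes (Q_l R) = {loc_ideal R (S_l R) \<pp> |\<pp>. \<pp> \<in> min_primes R} \<and>
      (\<forall>\<pp>\<in>min_primes R.
        quot_map R \<pp> ` S_l R \<in> Den_l (R Quot \<pp>) {\<zero>\<^bsub>R Quot \<pp>\<^esub>} \<and>
        left_loc (R Quot \<pp>) (quot_map R \<pp> ` S_l R)
          \<simeq> left_loc R (S_l R) Quot loc_ideal R (S_l R) \<pp> \<and>
        left_loc R (S_l R) Quot loc_ideal R (S_l R) \<pp>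
          \<simeq> Q_l R Quot loc_ideal R (S_l R) \<pp> \<and>
        left_module_iso (Q_l R)
          (quot_module (Q_l R) (loc_ideal R (S_l R) \<pp>))
          (left_loc_module R (S_l R) (quot_module R \<pp>)) \<noteq> {}) \<and>
      (\<forall>\<pp>\<in>min_primes R.
        quot_map R \<pp> ` S_l R \<subseteq> S_l (R Quot \<pp>) \<and>
        (\<exists>f\<in>ring_hom (Q_l R Quot loc_ideal R (S_l R) \<pp>) (Q_l (R Quot \<pp>)).
          inj_on f (carrier (Q_l R Quot loc_ideal R (S_l R) \<pp>)) \<and>
          (\<forall>s\<in>S_l R. \<forall>r\<in>carrier R.
            f (loc_ideal R (S_l R) \<pp> +>\<^bsub>Q_l R\<^esub> ring_frac R (S_l R) s r)
              = ring_frac (R Quot \<pp>) (S_l (R Quot \<pp>))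
                  (quot_map R \<pp> s) (quot_map R \<pp> r)))))"
proof -
  interpret semiprime_ring R by fact
  interpret regular_left_Ore R "S_l R"
    by (rule regular_left_Ore_S_l[OF ring_axioms one_neq_zero])
  show ?thesis
    unfolding Q_l_def
  proof (intro conjI impI ballI semiprime_left_loc assms)
    assume fin: "finite (min_primes R)"
    interpret semiprime_left_Ore R "S_l R"
      by unfold_locales (rule fin)
    show "min_primes (left_loc R (S_l R)) = {loc_ideal R (S_l R) \<pp> |\<pp>. \<pp> \<in> min_primes R}"
      by (rule min_primes_left_loc)
    fix \<pp> assume "\<pp> \<in> min_primes R"
    then interpret \<pp>: saturated_ideal R "S_l R" \<pp> by (rule saturated_min_prime)
    show "quot_map R \<pp> ` S_l R \<in> Den_l (R Quot \<pp>) {\<zero>\<^bsub>R Quot \<pp>\<^esub>}"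
      by (rule \<pp>.quot_image_Den_l)
    show "left_loc (R Quot \<pp>) (quot_map R \<pp> ` S_l R)
        \<simeq> left_loc R (S_l R) Quot loc_ideal R (S_l R) \<pp>"
      by (rule \<pp>.left_loc_quot_iso)
    \<comment> \<open>With \<open>Q_l\<close> unfolded both sides are the same ring, so the identity
      is the isomorphism.\<close>
    show "left_loc R (S_l R) Quot loc_ideal R (S_l R) \<pp>
        \<simeq> left_loc R (S_l R) Quot loc_ideal R (S_l R) \<pp>"
      using ring_iso_set_refl by (auto simp: is_ring_iso_def)
    show "left_module_iso (left_loc R (S_l R))
        (quot_module (left_loc R (S_l R)) (loc_ideal R (S_l R) \<pp>))
        (left_loc_module R (S_l R) (quot_module R \<pp>)) \<noteq> {}"
      by (rule \<pp>.quot_left_loc_module_iso)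
    show sub: "quot_map R \<pp> ` S_l R \<subseteq> S_l (R Quot \<pp>)"
      by (rule \<pp>.quot_image_subset_S_l)
    have "regular_left_Ore (R Quot \<pp>) (S_l (R Quot \<pp>))"
      by (rule regular_left_Ore_S_l[OF \<pp>.quotient_is_ring \<pp>.quot_one_not_zero])
    then show "\<exists>f\<in>ring_hom (left_loc R (S_l R) Quot loc_ideal R (S_l R) \<pp>)
        (left_loc (R Quot \<pp>) (S_l (R Quot \<pp>))).
        inj_on f (carrier (left_loc R (S_l R) Quot loc_ideal R (S_l R) \<pp>)) \<and>
        (\<forall>s\<in>S_l R. \<forall>r\<in>carrier R.
          f (loc_ideal R (S_l R) \<pp> +>\<^bsub>left_loc R (S_l R)\<^esub> ring_frac R (S_l R) s r)
            = ring_frac (R Quot \<pp>) (S_l (R Quot \<pp>)) (quot_map R \<pp> s) (quot_map R \<pp> r))"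
      using sub by (rule \<pp>.left_loc_quot_embedding)
  qed
qed

end
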